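(* Let $N\ge 1$, let $\Omega\subset\mathbb{R}^N$ be a bounded open set, and let $A\in (L^\infty(\Omega))^{N\times N}$ be a matrix-valued function for which there exists $\alpha>0$ with $A(x)\xi\cdot\xi\ge\alpha|\xi|^2$ for a.e. $x\in\Omega$ and all $\xi\in\mathbb{R}^N$. Let $F:\Omega\times[0,+\infty)\to[0,+\infty]$ be a Carathéodory function (i.e. $x\mapsto F(x,s)$ is measurable for every $s\in[0,+\infty)$, and for a.e. $x\in\Omega$ the map $s\mapsto F(x,s)\in[0,+\infty]$ is continuous on $[0,+\infty)$) such that $$0\le F(x,s)\le \frac{h(x)}{\Gamma(s)}\quad\text{for a.e. } x\in\Omega,\ \forall s>0,$$ where $h\ge 0$ a.e., $h\in L^r(\Omega)$ with $r=\frac{2N}{N+2}$ if $N\ge3$, $r>1$ if $N=2$, $r=1$ if $N=1$, and where $\Gamma:[0,+\infty)\to[0,+\infty)$ is of class $C^1([0,+\infty))$ with $\Gamma(0)=0$ and $\Gamma'(s)>0$ for all $s>0$. Assume moreover that $F$ is nonincreasing in $s$, i.e. $F(x,s)\le F(x,t)$ for a.e. $x\in\Omega$ and all $s,t$ with $0\le t\le s$. Then the solution, in the sense of the definition given in the context, to the problem $$u\ge 0\ \text{in }\Omega,\qquad -\operatorname{div}A(x)Du=F(x,u)\ \text{in }\Omega,\qquad u=0\ \text{on }\partial\Omega$$ is unique (any two solutions coincide a.e. in $\Omega$).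
   Context: All functions are real-valued unless otherwise said; $D$ denotes the gradient, ${}^tA$ the transpose of $A$, $\mathcal{D}(\Omega)=C_c^\infty(\Omega)$, $\mathcal{D}'(\Omega)$ the distributions on $\Omega$; no regularity of $\partial\Omega$ is assumed. For $k>0$ and $s\in\mathbb{R}$: $T_k(s)=\max\{-k,\min\{s,k\}\}$, $G_k(s)=s-T_k(s)$. Test functions. For $\hat\varphi\in H_0^1(\Omega)\cap L^\infty(\Omega)$ and $\hat g\in(L^2(\Omega))^N$, the distribution $\hat\varphi(-\operatorname{div}\hat g)$ is defined by $\langle\hat\varphi(-\operatorname{div}\hat g),\phi\rangle=\int_\Omega\hat g\cdot D(\hat\varphi\phi)$ for $\phi\in\mathcal{D}(\Omega)$. The space $\mathcal{V}(\Omega)$ is the set of $v\in H_0^1(\Omega)\cap L^\infty(\Omega)$ for which there exist a finite set $I$, functions $\hat\varphi_i\in H_0^1(\Omega)\cap L^\infty(\Omega)$, $\hat g_i\in(L^2(\Omega))^N$ ($i\in I$) and $\hat f\in L^1(\Omega)$ such that $$-\operatorname{div}\,{}^tA(x)Dv=\sum_{i\in I}\hat\varphi_i(-\operatorname{div}\hat g_i)+\hat f\quad\text{in }\mathcal{D}'(\Omega).\qquad( * )$$ Definition of solution. A function $u$ is a solution to the problem $u\ge0$, $-\operatorname{div}A(x)Du=F(x,u)$ in $\Omega$, $u=0$ on $\partial\Omega$ if: (1) $u\in L^2(\Omega)\cap H^1_{\rm loc}(\Omega)$; $u(x)\ge0$ for a.e. $x\in\Omega$; $G_k(u)\in H_0^1(\Omega)$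 for all $k>0$; and $\varphi T_k(u)\in H_0^1(\Omega)$ for all $k>0$ and all $\varphi\in H_0^1(\Omega)\cap L^\infty(\Omega)$; (2) for every $v\in\mathcal{V}(\Omega)$ with $v\ge0$, and every $I,\hat\varphi_i,\hat g_i,\hat f$ as in $( * )$, one has $\int_\Omega F(x,u)v<+\infty$ (with the usual convention $0\cdot\infty=0$ in integrands) and $$\int_\Omega{}^tA(x)Dv\cdot DG_k(u)+\sum_{i\in I}\int_\Omega\hat g_i\cdot D(\hat\varphi_iT_k(u))+\int_\Omega\hat f\,T_k(u)=\int_\Omega F(x,u)v\qquad\forall k>0.$$ *)

theory Defs
  imports "HOL-Analysis.Analysis"
begin

text \<open>Functions on an open set \<open>\<Omega>\<close> of \<open>\<real>\<^sup>N\<close> are total functions on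
  \<open>real ^ 'n\<close>, with \<open>N = CARD('n)\<close>; only their values on \<open>\<Omega>\<close> matter, and elements of
  Lebesgue and Sobolev spaces are representatives, not equivalence classes.\<close>

subsection \<open>Test functions\<close>

definition grad :: "(real ^ 'n \<Rightarrow> real) \<Rightarrow> real ^ 'n \<Rightarrow> real ^ 'n" where
  "grad f x = (\<chi> i. frechet_derivative f (at x) (axis i 1))"

fun C_k :: "nat \<Rightarrow> (real ^ 'n \<Rightarrow> real) \<Rightarrow> bool" where
  "C_k 0 f \<longleftrightarrow> continuous_on UNIV f"
| "C_k (Suc k) f \<longleftrightarrow> f differentiable_on UNIV \<and> (\<forall>i. C_k k (\<lambda>x. grad f x $ i))"

text \<open>Elements of \<open>C\<^sub>c\<^sup>\<infinity>(\<Omega>)\<close> are extended by zero to the whole space.\<close>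

definition test_functions :: "(real ^ 'n) set \<Rightarrow> (real ^ 'n \<Rightarrow> real) set" where
  "test_functions \<Omega> =
     {\<phi>. (\<forall>k. C_k k \<phi>) \<and> compact (closure {x. \<phi> x \<noteq> 0}) \<and> closure {x. \<phi> x \<noteq> 0} \<subseteq> \<Omega>}"

subsection \<open>Lebesgue spaces\<close>

text \<open>For exponents \<open>1 \<le> p < \<infinity>\<close>.\<close>

definition L_space :: "real \<Rightarrow> (real ^ 'n) set \<Rightarrow> (real ^ 'n \<Rightarrow> 'b::euclidean_space) set" where
  "L_space p \<Omega> = {f \<in> borel_measurable (lebesgue_on \<Omega>).
     integrable (lebesgue_on \<Omega>) (\<lambda>x. norm (f x) powr p)}"

definition Linf_space :: "(real ^ 'n) set \<Rightarrow> (real ^ 'n \<Rightarrow> real) set" where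
  "Linf_space \<Omega> = {f \<in> borel_measurable (lebesgue_on \<Omega>).
     \<exists>C. AE x in lebesgue_on \<Omega>. \<bar>f x\<bar> \<le> C}"

definition L1_loc :: "(real ^ 'n) set \<Rightarrow> (real ^ 'n \<Rightarrow> 'b::euclidean_space) set" where
  "L1_loc \<Omega> = {f. \<forall>K. compact K \<and> K \<subseteq> \<Omega> \<longrightarrow> set_integrable lebesgue K f}"

subsection \<open>Sobolev spaces\<close>

definition has_weak_grad ::
    "(real ^ 'n) set \<Rightarrow> (real ^ 'n \<Rightarrow> real) \<Rightarrow> (real ^ 'n \<Rightarrow> real ^ 'n) \<Rightarrow> bool" where
  "has_weak_grad \<Omega> u g \<longleftrightarrow> u \<in> L1_loc \<Omega> \<and> g \<in> L1_loc \<Omega> \<and>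
     (\<forall>\<phi>\<in>test_functions \<Omega>. \<forall>i.
        (LINT x|lebesgue_on \<Omega>. u x * grad \<phi> x $ i) = - (LINT x|lebesgue_on \<Omega>. g x $ i * \<phi> x))"

text \<open>The weak gradient is determined only up to null sets. The choice made here is
  meaningful only for functions that have a weak gradient.\<close>

definition weak_grad :: "(real ^ 'n) set \<Rightarrow> (real ^ 'n \<Rightarrow> real) \<Rightarrow> real ^ 'n \<Rightarrow> real ^ 'n" where
  "weak_grad \<Omega> u = (SOME g. has_weak_grad \<Omega> u g)"

definition H1 :: "(real ^ 'n) set \<Rightarrow> (real ^ 'n \<Rightarrow> real) set" where
  "H1 \<Omega> = {u \<in> L_space 2 \<Omega>. \<exists>g \<in> L_space 2 \<Omega>. has_weak_grad \<Omega> u g}"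

definition H1_loc :: "(real ^ 'n) set \<Rightarrow> (real ^ 'n \<Rightarrow> real) set" where
  "H1_loc \<Omega> = {u. \<forall>\<omega>. open \<omega> \<and> compact (closure \<omega>) \<and> closure \<omega> \<subseteq> \<Omega> \<longrightarrow> u \<in> H1 \<omega>}"

text \<open>\<open>H\<^sub>0\<^sup>1(\<Omega>)\<close> is the closure of the test functions in the norm of \<open>H\<^sup>1(\<Omega>)\<close>.\<close>

definition H10 :: "(real ^ 'n) set \<Rightarrow> (real ^ 'n \<Rightarrow> real) set" where
  "H10 \<Omega> = {u \<in> H1 \<Omega>. \<exists>\<phi> :: nat \<Rightarrow> real ^ 'n \<Rightarrow> real.
     (\<forall>m. \<phi> m \<in> test_functions \<Omega>) \<and>
     (\<lambda>m. (LINT x|lebesgue_on \<Omega>. (\<phi> m x - u x)\<^sup>2)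
        + (LINT x|lebesgue_on \<Omega>. (norm (grad (\<phi> m) x - weak_grad \<Omega> u x))\<^sup>2)) \<longlonglongrightarrow> 0}"

subsection \<open>Truncations\<close>

definition T :: "real \<Rightarrow> real \<Rightarrow> real" where
  "T k s = max (- k) (min s k)"

definition G :: "real \<Rightarrow> real \<Rightarrow> real" where
  "G k s = s - T k s"

subsection \<open>The space of test functions \<open>\<V>(\<Omega>)\<close>\<close>

text \<open>Distributions are given by their action on \<open>\<psi> \<in> test_functions \<Omega>\<close>:
  \<open>- div g\<close>, \<open>\<phi> (- div g)\<close> and \<open>f\<close>, in this order.\<close>

definition neg_div ::
    "(real ^ 'n) set \<Rightarrow> (real ^ 'n \<Rightarrow> real ^ 'n) \<Rightarrow> (real ^ 'n \<Rightarrow> real) \<Rightarrow> real" where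
  "neg_div \<Omega> g \<psi> = (LINT x|lebesgue_on \<Omega>. g x \<bullet> grad \<psi> x)"

definition mult_neg_div :: "(real ^ 'n) set \<Rightarrow> (real ^ 'n \<Rightarrow> real) \<Rightarrow> (real ^ 'n \<Rightarrow> real ^ 'n) \<Rightarrow>
    (real ^ 'n \<Rightarrow> real) \<Rightarrow> real" where
  "mult_neg_div \<Omega> \<phi> g \<psi> = (LINT x|lebesgue_on \<Omega>. g x \<bullet> weak_grad \<Omega> (\<lambda>y. \<phi> y * \<psi> y) x)"

definition fun_distr :: "(real ^ 'n) set \<Rightarrow> (real ^ 'n \<Rightarrow> real) \<Rightarrow> (real ^ 'n \<Rightarrow> real) \<Rightarrow> real" where
  "fun_distr \<Omega> f \<psi> = (LINT x|lebesgue_on \<Omega>. f x * \<psi> x)"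

text \<open>\<open>V_data \<Omega> A v I \<phi> g f\<close> says that
  \<open>- div (\<^sup>tA Dv) = (\<Sum>i\<in>I. \<phi> i (- div (g i))) + f\<close> holds in the sense of distributions, with data
  in the required spaces. The finite index set is a set of natural numbers without loss of
  generality.\<close>

definition V_data :: "(real ^ 'n) set \<Rightarrow> (real ^ 'n \<Rightarrow> real ^ 'n ^ 'n) \<Rightarrow> (real ^ 'n \<Rightarrow> real) \<Rightarrow>
    nat set \<Rightarrow> (nat \<Rightarrow> real ^ 'n \<Rightarrow> real) \<Rightarrow> (nat \<Rightarrow> real ^ 'n \<Rightarrow> real ^ 'n) \<Rightarrow>
    (real ^ 'n \<Rightarrow> real) \<Rightarrow> bool" where
  "V_data \<Omega> A v I \<phi> g f \<longleftrightarrow>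
     finite I \<and>
     (\<forall>i\<in>I. \<phi> i \<in> H10 \<Omega> \<inter> Linf_space \<Omega> \<and> g i \<in> L_space 2 \<Omega>) \<and>
     f \<in> L_space 1 \<Omega> \<and>
     (\<forall>\<psi>\<in>test_functions \<Omega>.
        neg_div \<Omega> (\<lambda>x. transpose (A x) *v weak_grad \<Omega> v x) \<psi>
        = (\<Sum>i\<in>I. mult_neg_div \<Omega> (\<phi> i) (g i) \<psi>) + fun_distr \<Omega> f \<psi>)"

definition V_space ::
    "(real ^ 'n) set \<Rightarrow> (real ^ 'n \<Rightarrow> real ^ 'n ^ 'n) \<Rightarrow> (real ^ 'n \<Rightarrow> real) set" where
  "V_space \<Omega> A = {v \<in> H10 \<Omega> \<inter> Linf_space \<Omega>. \<exists>I \<phi> g f. V_data \<Omega> A v I \<phi> g f}"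

subsection \<open>Nonlinearities and solutions\<close>

text \<open>\<open>F x s\<close> is only relevant for \<open>s \<ge> 0\<close>.\<close>

definition caratheodory :: "(real ^ 'n) set \<Rightarrow> (real ^ 'n \<Rightarrow> real \<Rightarrow> ennreal) \<Rightarrow> bool" where
  "caratheodory \<Omega> F \<longleftrightarrow>
     (\<forall>s\<ge>0. (\<lambda>x. F x s) \<in> borel_measurable (lebesgue_on \<Omega>)) \<and>
     (AE x in lebesgue_on \<Omega>. continuous_on {0..} (F x))"

text \<open>In \<open>ennreal\<close>, \<open>0 * \<infinity> = 0\<close>; \<open>enn2real\<close> is applied only to an integral that is required to
  be finite.\<close>

definition is_solution :: "(real ^ 'n) set \<Rightarrow> (real ^ 'n \<Rightarrow> real ^ 'n ^ 'n) \<Rightarrow>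
    (real ^ 'n \<Rightarrow> real \<Rightarrow> ennreal) \<Rightarrow> (real ^ 'n \<Rightarrow> real) \<Rightarrow> bool" where
  "is_solution \<Omega> A F u \<longleftrightarrow>
     (u \<in> L_space 2 \<Omega> \<inter> H1_loc \<Omega> \<and>
      (AE x in lebesgue_on \<Omega>. u x \<ge> 0) \<and>
      (\<forall>k>0. (\<lambda>x. G k (u x)) \<in> H10 \<Omega>) \<and>
      (\<forall>k>0. \<forall>\<phi>\<in>H10 \<Omega> \<inter> Linf_space \<Omega>. (\<lambda>x. \<phi> x * T k (u x)) \<in> H10 \<Omega>)) \<and>
     (\<forall>v\<in>V_space \<Omega> A. (AE x in lebesgue_on \<Omega>. v x \<ge> 0) \<longrightarrow>
       (\<forall>I \<phi> g f. V_data \<Omega> A v I \<phi> g f \<longrightarrow>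
         (\<integral>\<^sup>+x. F x (u x) * ennreal (v x) \<partial>lebesgue_on \<Omega>) < \<infinity> \<and>
         (\<forall>k>0.
           (LINT x|lebesgue_on \<Omega>.
              (transpose (A x) *v weak_grad \<Omega> v x) \<bullet> weak_grad \<Omega> (\<lambda>y. G k (u y)) x)
           + (\<Sum>i\<in>I. LINT x|lebesgue_on \<Omega>. g i x \<bullet> weak_grad \<Omega> (\<lambda>y. \<phi> i y * T k (u y)) x)
           + (LINT x|lebesgue_on \<Omega>. f x * T k (u x))
           = enn2real (\<integral>\<^sup>+x. F x (u x) * ennreal (v x) \<partial>lebesgue_on \<Omega>))))"

end

theory Submission
  imports Defs "HOL-Computational_Algebra.Polynomial"
begin

text \<open>Let \<open>u\<close> and \<open>w\<close> be two solutions. Formally, subtracting the two equations and testing with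
  \<open>(u - w)\<^sup>+\<close> gives \<open>\<alpha> \<integral>|D(u - w)\<^sup>+|\<^sup>2 \<le> \<integral>(F(x,u) - F(x,w)) (u - w)\<^sup>+ \<le> 0\<close>, since \<open>F\<close> is nonincreasing in
  its second argument; hence \<open>u \<le> w\<close>. The obstacle is that \<open>u\<close> and \<open>w\<close> themselves need not belong to
  \<open>H\<^sub>0\<^sup>1(\<Omega>)\<close>; only \<open>G\<^sub>k(u)\<close> and \<open>\<phi> T\<^sub>k(u)\<close> with \<open>\<phi> \<in> H\<^sub>0\<^sup>1(\<Omega>) \<inter> L\<^sup>\<infinity>(\<Omega>)\<close> do, and the test functions have to
  lie in \<open>\<V>(\<Omega>)\<close>.

  The way around it is to compare up to a constant. Fix \<open>k > 0\<close> and put \<open>Q = G\<^sub>k(u)\<close>. Let \<open>\<eta>\<close> be a smooth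
  function of \<open>Q\<close> which vanishes for \<open>Q = 0\<close> and is \<open>1\<close> for \<open>Q \<ge> k\<close>; then
  \<open>P = \<eta> T\<^sub>k(w) + G\<^sub>k(w)\<close> is in \<open>H\<^sub>0\<^sup>1(\<Omega>)\<close>. As \<open>P \<ge> 0\<close>, the inequality \<open>Q - P > k\<close> forces \<open>Q > k\<close>, so that there
  \<open>u > 2k\<close>, \<open>\<eta> = 1\<close> and \<open>Q - P = u - k - w\<close>. Therefore \<open>z = flat (Q - P - k)\<close>, where \<open>flat\<close> is the smooth
  function \<open>exp(-1/t)\<close> extended by zero to \<open>t \<le> 0\<close>, is a bounded element of \<open>H\<^sub>0\<^sup>1(\<Omega>)\<close> which is
  positive precisely where \<open>u > w + 2k\<close>.

  The test function is \<open>z\<^sup>2\<close>. It lies in \<open>\<V>(\<Omega>)\<close> because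
  \<open>- div (\<^sup>tA D(z\<^sup>2)) = z (- div (2 \<^sup>tA Dz)) - 2 \<^sup>tA Dz \<cdot> Dz\<close>, and with these data the equation for \<open>u\<close> becomes
  \<open>2 \<integral>\<^sup>tA Dz \<cdot> W\<^sub>u = \<integral>F(x,u) z\<^sup>2\<close> with \<open>W\<^sub>u = z DG\<^sub>k(u) + D(z T\<^sub>k(u)) - T\<^sub>k(u) Dz\<close>, a rigorous form of \<open>z Du\<close>
  (lemma \<open>solution_identity\<close>). Subtracting the same identity for \<open>w\<close>, one finds
  \<open>W\<^sub>u - W\<^sub>w = z D(Q - P)\<close>, and monotonicity of \<open>F\<close> together with ellipticity of \<open>A\<close> yields \<open>Dz = 0\<close>, hence
  \<open>z = 0\<close>, that is \<open>u \<le> w + 2k\<close> (lemma \<open>comparison_up_to_constant\<close>). Letting \<open>k\<close> tend to \<open>0\<close> and exchanging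
  \<open>u\<close> and \<open>w\<close> finishes the proof.

  The Sobolev calculus needed for this is obtained by approximation with test functions. Since only smooth
  functions of elements of \<open>H\<^sub>0\<^sup>1(\<Omega>)\<close> occur, the chain rule maps approximating test functions to
  test functions, and no mollification is involved. The weak gradient is unique almost everywhere by the
  fundamental lemma of the calculus of variations, whose bump functions are again built from \<open>flat\<close>.\<close>

section \<open>Gradients and functions of class \<open>C\<^sup>k\<close>\<close>

text \<open>The gradient of the coordinates determines the whole derivative; this turns the calculus
  rules for \<open>has_derivative\<close> into rules for \<open>grad\<close>.\<close>

lemma has_derivative_grad:
  fixes f :: "real ^ 'n \<Rightarrow> real"
  assumes "f differentiable (at x)"
  shows "(f has_derivative (\<lambda>h. grad f x \<bullet> h)) (at x)"
proof -
  have d: "(f has_derivative frechet_derivative f (at x)) (at x)"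
    using assms frechet_derivative_works by blast
  interpret linear "frechet_derivative f (at x)"
    using d has_derivative_linear by blast
  have "frechet_derivative f (at x) h = grad f x \<bullet> h" for h
  proof -
    have "frechet_derivative f (at x) h = frechet_derivative f (at x) (\<Sum>i\<in>UNIV. h $ i *\<^sub>R axis i 1)"
      using basis_expansion[of h] by (simp add: scalar_mult_eq_scaleR)
    also have "\<dots> = grad f x \<bullet> h"
      by (simp add: sum scale grad_def inner_vec_def mult.commute)
    finally show ?thesis .
  qed
  then have "frechet_derivative f (at x) = (\<lambda>h. grad f x \<bullet> h)" by (rule ext)
  with d show ?thesis by simp
qed

lemma grad_eqI:
  fixes f :: "real ^ 'n \<Rightarrow> real"
  assumes "(f has_derivative D) (at x)"
  shows "grad f x $ i = D (axis i 1)"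
  using frechet_derivative_at[OF assms] by (simp add: grad_def)

lemma grad_mult:
  fixes f g :: "real ^ 'n \<Rightarrow> real"
  assumes "f differentiable (at x)" "g differentiable (at x)"
  shows "grad (\<lambda>x. f x * g x) x = f x *\<^sub>R grad g x + g x *\<^sub>R grad f x"
proof -
  have "((\<lambda>x. f x * g x) has_derivative (\<lambda>h. f x * (grad g x \<bullet> h) + (grad f x \<bullet> h) * g x)) (at x)"
    by (intro has_derivative_mult has_derivative_grad assms)
  from grad_eqI[OF this] show ?thesis
    by (simp add: vec_eq_iff inner_axis)
qed

lemma grad_add:
  fixes f g :: "real ^ 'n \<Rightarrow> real"
  assumes "f differentiable (at x)" "g differentiable (at x)"
  shows "grad (\<lambda>x. f x + g x) x = grad f x + grad g x"
proof -
  have "((\<lambda>x. f x + g x) has_derivative (\<lambda>h. (grad f x \<bullet> h) + (grad g x \<bullet> h))) (at x)"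
    by (intro has_derivative_add has_derivative_grad assms)
  from grad_eqI[OF this] show ?thesis
    by (simp add: vec_eq_iff inner_axis)
qed

lemma grad_const: "grad (\<lambda>_. c) x = (0 :: real ^ 'n)"
  by (simp add: vec_eq_iff grad_eqI[OF has_derivative_const])

lemma grad_component: "grad (\<lambda>x. x $ i) x $ j = (if i = j then 1 else 0 :: real)"
  by (subst grad_eqI[OF bounded_linear_imp_has_derivative[OF bounded_linear_vec_nth]])
    (simp add: axis_def)

lemma grad_compose:
  fixes f :: "real ^ 'n \<Rightarrow> real"
  assumes "f differentiable (at x)" "(S has_real_derivative S') (at (f x))"
  shows "grad (\<lambda>x. S (f x)) x = S' *\<^sub>R grad f x"
proof -
  have "((\<lambda>x. S (f x)) has_derivative (\<lambda>h. S' * (grad f x \<bullet> h))) (at x)"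
    using has_derivative_compose[OF has_derivative_grad[OF assms(1)], of S "(*) S'"] assms(2)
    by (simp add: has_field_derivative_def)
  from grad_eqI[OF this] show ?thesis
    by (simp add: vec_eq_iff inner_axis)
qed

lemma C_k_antimono: "C_k (Suc k) f \<Longrightarrow> C_k k f"
proof (induction k arbitrary: f)
  case 0
  then show ?case by (simp add: differentiable_imp_continuous_on)
next
  case (Suc k)
  then show ?case by (metis C_k.simps(2))
qed

lemma C_k_const: "C_k k (\<lambda>_. c)"
  by (induction k arbitrary: c) (simp_all add: grad_const)

lemma C_k_component: "C_k k (\<lambda>x. x $ i)"
proof (cases k)
  case 0 then show ?thesis by (simp add: continuous_on_component)
next
  case (Suc m)
  have "(\<lambda>x. x $ i) differentiable_on UNIV"
    by (metis bounded_linear_imp_differentiable_on bounded_linear_vec_nth)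
  then show ?thesis using Suc by (simp add: grad_component C_k_const)
qed

lemma C_k_add: "C_k k f \<Longrightarrow> C_k k g \<Longrightarrow> C_k k (\<lambda>x. f x + g x)"
proof (induction k arbitrary: f g)
  case 0 then show ?case by (simp add: continuous_on_add)
next
  case (Suc k)
  then have d: "f differentiable (at x)" "g differentiable (at x)" for x
    by (simp_all add: differentiable_on_def)
  show ?case using Suc d
    by (simp add: grad_add differentiable_on_def)
qed

lemma C_k_mult: "C_k k f \<Longrightarrow> C_k k g \<Longrightarrow> C_k k (\<lambda>x. f x * g x)"
proof (induction k arbitrary: f g)
  case 0 then show ?case by (simp add: continuous_on_mult)
next
  case (Suc k)
  then have d: "f differentiable (at x)" "g differentiable (at x)" for x
    by (simp_all add: differentiable_on_def)
  have "C_k k f" "C_k k g" using Suc.prems C_k_antimono by blast+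
  with Suc d show ?case
    by (simp add: grad_mult differentiable_on_def C_k_add)
qed

lemma C_k_prod:
  assumes "\<And>i. i \<in> I \<Longrightarrow> C_k k (f i)"
  shows "C_k k (\<lambda>x. \<Prod>i\<in>I. f i x)"
  using assms by (induction I rule: infinite_finite_induct) (auto simp: C_k_const C_k_mult)

text \<open>Smoothness on the line is witnessed by the sequence of all derivatives, which makes
  the induction in the composition lemma immediate.\<close>

definition smooth_real :: "(real \<Rightarrow> real) \<Rightarrow> bool" where
  "smooth_real S \<longleftrightarrow> (\<exists>D :: nat \<Rightarrow> real \<Rightarrow> real. D 0 = S \<and>
     (\<forall>m x. (D m has_real_derivative D (Suc m) x) (at x)))"

text \<open>The induction has to run over all derivatives of \<open>S\<close> at once, because the gradient of
  \<open>S \<circ> f\<close> contains \<open>S' \<circ> f\<close>.\<close>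

lemma C_k_compose:
  assumes "smooth_real S" "C_k k f"
  shows "C_k k (\<lambda>x. S (f x))"
proof -
  obtain D :: "nat \<Rightarrow> real \<Rightarrow> real" where D0: "D 0 = S"
    and D: "\<And>m x. (D m has_real_derivative D (Suc m) x) (at x)"
    using assms(1) unfolding smooth_real_def by auto
  have "C_k k (\<lambda>x. D m (f x))" for m using assms(2)
  proof (induction k arbitrary: m)
    case 0
    have "continuous_on UNIV (D m)" by (meson D DERIV_continuous_on has_field_derivative_at_within)
    with 0 show ?case by (simp add: continuous_on_compose2[of UNIV "D m" UNIV f])
  next
    case (Suc k)
    then have d: "f differentiable (at x)" for x by (simp add: differentiable_on_def)
    have "(\<lambda>x. D m (f x)) differentiable (at x)" for x
      by (metis D d differentiable_compose[of "D m" f x UNIV] real_differentiable_def)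
    moreover have "C_k k f" using Suc.prems C_k_antimono by blast
    ultimately show ?case using Suc
      by (simp add: grad_compose[OF d D] differentiable_on_def C_k_mult)
  qed
  then show ?thesis using D0 by metis
qed

lemma smooth_real_affine:
  assumes "smooth_real S"
  shows "smooth_real (\<lambda>s. c + a * S (b * s + d))"
proof -
  obtain D :: "nat \<Rightarrow> real \<Rightarrow> real" where D0: "D 0 = S"
    and D: "\<And>m x. (D m has_real_derivative D (Suc m) x) (at x)"
    using assms(1) unfolding smooth_real_def by auto
  define D' where "D' m s = (if m = 0 then c else 0) + a * b ^ m * D m (b * s + d)" for m s
  have "(D' m has_real_derivative D' (Suc m) x) (at x)" for m x
    unfolding D'_def by (auto intro!: derivative_eq_intros DERIV_chain'[OF _ D])
  moreover have "D' 0 = (\<lambda>s. c + a * S (b * s + d))" by (auto simp: D'_def D0)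
  ultimately show ?thesis unfolding smooth_real_def by blast
qed

section \<open>The smooth function \<open>exp(-1/t)\<close> extended by zero\<close>

definition flat :: "real \<Rightarrow> real" where
  "flat t = (if t > 0 then exp (- (1 / t)) else 0)"

definition flat' :: "real \<Rightarrow> real" where
  "flat' t = (if t > 0 then exp (- (1 / t)) / t\<^sup>2 else 0)"

text \<open>The \<open>m\<close>-th derivative of \<open>exp(-1/t)\<close> for \<open>t > 0\<close> is \<open>p\<^sub>m(1/t) exp(-1/t)\<close>, where differentiation of
  such an expression turns \<open>p\<^sub>m\<close> into \<open>X\<^sup>2 (p\<^sub>m - p\<^sub>m')\<close>.\<close>

fun flat_poly :: "nat \<Rightarrow> real poly" where
  "flat_poly 0 = 1"
| "flat_poly (Suc m) = [:0, 0, 1:] * (flat_poly m - pderiv (flat_poly m))"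

definition flat_deriv :: "nat \<Rightarrow> real \<Rightarrow> real" where
  "flat_deriv m t = (if t > 0 then poly (flat_poly m) (1 / t) * exp (- (1 / t)) else 0)"

lemma tendsto_poly_exp: "((\<lambda>y. poly q y * exp (- y)) \<longlongrightarrow> (0::real)) at_top"
proof -
  have "((\<lambda>y. y ^ n * poly q y * exp (- y)) \<longlongrightarrow> (0::real)) at_top" for n
  proof (induction q arbitrary: n)
    case 0 then show ?case by simp
  next
    case (pCons a q)
    have "((\<lambda>y. a * (y ^ n / exp y) + y ^ Suc n * poly q y * exp (- y)) \<longlongrightarrow> a * 0 + (0::real)) at_top"
      by (intro tendsto_intros tendsto_power_div_exp_0 pCons)
    then show ?case
      by (simp add: algebra_simps exp_minus divide_inverse)
  qed
  from this[of 0] show ?thesis by simp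
qed

text \<open>Away from \<open>0\<close> this is the recursion for \<open>flat_poly\<close>; at \<open>0\<close> the difference quotient
  tends to zero since \<open>exp(-1/t)\<close> decays faster than any power of \<open>1/t\<close> grows.\<close>

lemma flat_deriv_deriv: "(flat_deriv m has_real_derivative flat_deriv (Suc m) x) (at x)"
proof (cases x "0::real" rule: linorder_cases)
  case less
  have "((\<lambda>_. 0::real) has_real_derivative 0) (at x)" by simp
  then have "(flat_deriv m has_real_derivative 0) (at x)"
    by (rule has_field_derivative_transform_within_open[of _ _ _ "{..<0}"]) (use less in \<open>auto simp: flat_deriv_def\<close>)
  then show ?thesis using less by (simp add: flat_deriv_def)
next
  case greater
  have "((\<lambda>t. poly (flat_poly m) (1 / t) * exp (- (1 / t))) has_real_derivative
      poly (flat_poly (Suc m)) (1 / x) * exp (- (1 / x))) (at x)"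
    using greater
    by (auto intro!: derivative_eq_intros DERIV_chain'[OF _ poly_DERIV] simp: field_simps power2_eq_square)
  then have "(flat_deriv m has_real_derivative poly (flat_poly (Suc m)) (1 / x) * exp (- (1 / x))) (at x)"
    by (rule has_field_derivative_transform_within_open[of _ _ _ "{0<..}"]) (use greater in \<open>auto simp: flat_deriv_def\<close>)
  then show ?thesis using greater by (simp add: flat_deriv_def)
next
  case equal
  have "((\<lambda>h. flat_deriv m h / h) \<longlongrightarrow> 0) (at_left 0)"
    by (rule tendsto_eventually) (auto simp: eventually_at_left_field flat_deriv_def intro!: exI[of _ "-1"])
  moreover have "((\<lambda>h. flat_deriv m h / h) \<longlongrightarrow> 0) (at_right 0)"
  proof -
    have "((\<lambda>y. poly (pCons 0 (flat_poly m)) y * exp (- y)) \<longlongrightarrow> 0) at_top" by (rule tendsto_poly_exp)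
    then have "((\<lambda>h. poly (pCons 0 (flat_poly m)) (inverse h) * exp (- (inverse h))) \<longlongrightarrow> 0) (at_right 0)"
      by (rule filterlim_compose[OF _ filterlim_inverse_at_top_right])
    then show ?thesis
      by (rule Lim_transform_eventually)
        (auto simp: eventually_at_right_field flat_deriv_def field_simps intro!: exI[of _ 1])
  qed
  ultimately have "((\<lambda>h. flat_deriv m h / h) \<longlongrightarrow> 0) (at 0)" by (simp add: filterlim_split_at)
  then show ?thesis using equal by (simp add: has_field_derivative_iff flat_deriv_def)
qed

lemma smooth_flat: "smooth_real flat"
  unfolding smooth_real_def
proof (intro exI conjI allI)
  show "flat_deriv 0 = flat" by (auto simp: flat_deriv_def flat_def fun_eq_iff)
qed (rule flat_deriv_deriv)

lemma flat_has_derivative: "(flat has_real_derivative flat' x) (at x)"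
proof -
  have "flat_deriv 0 = flat" "flat_deriv (Suc 0) = flat'"
    by (auto simp: flat_deriv_def flat_def flat'_def fun_eq_iff field_simps power2_eq_square)
  then show ?thesis using flat_deriv_deriv[of 0 x] by simp
qed

lemma flat_compose_has_derivative:
  assumes "(f has_real_derivative f') (at x)" "flat' (f x) * f' = D"
  shows "((\<lambda>x. flat (f x)) has_real_derivative D) (at x)"
  using DERIV_chain'[OF assms(1) flat_has_derivative] assms(2) by simp

lemma flat_nonneg: "0 \<le> flat t" and flat_le_1: "flat t \<le> 1"
  and flat_pos_iff: "0 < flat t \<longleftrightarrow> 0 < t" and flat_eq_0_iff: "flat t = 0 \<longleftrightarrow> t \<le> 0"
  by (auto simp: flat_def)

lemma flat_mono: "s \<le> t \<Longrightarrow> flat s \<le> flat t"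
  by (auto simp: flat_def frac_le)

text \<open>This identity makes the square of \<open>flat\<close> smooth by a mere rescaling.\<close>

lemma flat_double: "flat (t / 2) = (flat t)\<^sup>2"
  by (auto simp: flat_def power2_eq_square simp flip: exp_add)

lemma flat'_nonneg: "0 \<le> flat' t" and flat'_eq_0_iff: "flat' t = 0 \<longleftrightarrow> t \<le> 0"
  by (auto simp: flat'_def)

lemma flat'_le: "flat' t \<le> 2"
proof (cases "t > 0")
  case True
  define y where "y = 1 / t"
  have y: "y > 0" using True by (simp add: y_def)
  have "1 + y + y\<^sup>2 / 2 \<le> exp y" using exp_lower_Taylor_quadratic[of y] y by simp
  then have "y\<^sup>2 \<le> 2 * exp y" using y by (smt (verit) field_sum_of_halves)
  then have "y\<^sup>2 * exp (- y) \<le> 2" by (simp add: exp_minus field_simps)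
  then show ?thesis using True by (simp add: flat'_def y_def power_divide field_simps)
qed (simp add: flat'_def)

lemma continuous_flat': "continuous_on UNIV flat'"
proof -
  have "flat_deriv (Suc 0) = flat'"
    by (auto simp: flat_deriv_def flat'_def fun_eq_iff field_simps power2_eq_square)
  then show ?thesis
    by (metis flat_deriv_deriv DERIV_continuous_on has_field_derivative_at_within)
qed

section \<open>Test functions\<close>

definition smooth :: "(real ^ 'n \<Rightarrow> real) \<Rightarrow> bool" where
  "smooth f \<longleftrightarrow> (\<forall>k. C_k k f)"

lemma smooth_imp_differentiable: "smooth f \<Longrightarrow> f differentiable (at x)"
  unfolding smooth_def by (metis C_k.simps(2) UNIV_I differentiable_on_def)

lemma smooth_imp_continuous: "smooth f \<Longrightarrow> continuous_on UNIV f"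
  unfolding smooth_def by (metis C_k.simps(1))

lemma smooth_grad: "smooth f \<Longrightarrow> smooth (\<lambda>x. grad f x $ i)"
  unfolding smooth_def by (metis C_k.simps(2))

lemma continuous_grad: "smooth f \<Longrightarrow> continuous_on UNIV (grad f)"
  unfolding continuous_on_componentwise[of UNIV "grad f"]
  by (auto simp: Basis_vec_def inner_axis smooth_grad smooth_imp_continuous)

lemma test_functionsI:
  assumes "smooth f" "compact K" "K \<subseteq> \<Omega>" "\<And>x. x \<notin> K \<Longrightarrow> f x = 0"
  shows "f \<in> test_functions \<Omega>"
proof -
  have "closure {x. f x \<noteq> 0} \<subseteq> K"
    using assms(2,4) by (intro closure_minimal compact_imp_closed) auto
  moreover have "compact (closure {x. f x \<noteq> 0})"
    using calculation assms(2) by (metis closed_Int_compact closed_closure inf.absorb_iff1)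
  ultimately show ?thesis
    using assms unfolding test_functions_def smooth_def by auto
qed

lemma test_functionsE:
  assumes "f \<in> test_functions \<Omega>"
  obtains K where "smooth f" "compact K" "K \<subseteq> \<Omega>"
    "\<And>x. x \<notin> K \<Longrightarrow> f x = 0" "\<And>x. x \<notin> K \<Longrightarrow> grad f x = 0"
proof
  let ?K = "closure {x. f x \<noteq> 0}"
  show "smooth f" "compact ?K" "?K \<subseteq> \<Omega>" using assms by (auto simp: test_functions_def smooth_def)
  show 0: "f x = 0" if "x \<notin> ?K" for x
    using that subsetD[OF closure_subset, of x "{x. f x \<noteq> 0}"] by auto
  show "grad f x = 0" if "x \<notin> ?K" for x
  proof -
    have "((\<lambda>_. 0) has_derivative (\<lambda>_. 0)) (at x)" by simp
    then have "(f has_derivative (\<lambda>_. 0)) (at x)"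
    proof (rule has_derivative_transform_within_open)
      show "open (- ?K)" by (rule open_Compl) simp
      show "x \<in> - ?K" using that by blast
      show "0 = f y" if "y \<in> - ?K" for y using 0[of y] that by (metis ComplD)
    qed
    from grad_eqI[OF this] show ?thesis by (simp add: vec_eq_iff)
  qed
qed

lemma test_functions_smooth: "f \<in> test_functions \<Omega> \<Longrightarrow> smooth f"
  by (auto simp: test_functions_def smooth_def)

lemma test_functions_mult:
  assumes f: "f \<in> test_functions \<Omega>" and g: "smooth g"
  shows "(\<lambda>x. g x * f x) \<in> test_functions \<Omega>"
proof -
  obtain K where K: "smooth f" "compact K" "K \<subseteq> \<Omega>" "\<And>x. x \<notin> K \<Longrightarrow> f x = 0"
    using test_functionsE[OF f] by metis
  show ?thesis by (rule test_functionsI[OF _ K(2,3)]) (use K g in \<open>auto simp: smooth_def C_k_mult\<close>)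
qed

lemma test_functions_add:
  assumes f: "f \<in> test_functions \<Omega>" and g: "g \<in> test_functions \<Omega>"
  shows "(\<lambda>x. f x + g x) \<in> test_functions \<Omega>"
proof -
  obtain K where K: "smooth f" "compact K" "K \<subseteq> \<Omega>" "\<And>x. x \<notin> K \<Longrightarrow> f x = 0"
    using test_functionsE[OF f] by metis
  obtain L where L: "smooth g" "compact L" "L \<subseteq> \<Omega>" "\<And>x. x \<notin> L \<Longrightarrow> g x = 0"
    using test_functionsE[OF g] by metis
  show ?thesis
    by (rule test_functionsI[where K = "K \<union> L"]) (use K L in \<open>auto simp: smooth_def C_k_add\<close>)
qed

lemma test_functions_compose:
  assumes f: "f \<in> test_functions \<Omega>" and S: "smooth_real S" "S 0 = 0"
  shows "(\<lambda>x. S (f x)) \<in> test_functions \<Omega>"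
proof -
  obtain K where K: "smooth f" "compact K" "K \<subseteq> \<Omega>" "\<And>x. x \<notin> K \<Longrightarrow> f x = 0"
    using test_functionsE[OF f] by metis
  show ?thesis by (rule test_functionsI[OF _ K(2,3)]) (use K S in \<open>auto simp: smooth_def C_k_compose\<close>)
qed

lemma compact_support_bounded:
  fixes f :: "real ^ 'n \<Rightarrow> 'b::euclidean_space"
  assumes "continuous_on UNIV f" "compact K" "\<And>x. x \<notin> K \<Longrightarrow> f x = 0"
  obtains M where "M \<ge> 0" "\<And>x. norm (f x) \<le> M"
proof -
  have "bounded (f ` K)"
    using assms by (meson compact_continuous_image compact_imp_bounded continuous_on_subset subset_UNIV)
  then obtain M where M: "\<And>x. x \<in> K \<Longrightarrow> norm (f x) \<le> M" unfolding bounded_iff by auto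
  show ?thesis by (rule that[of "max M 0"]) (use M assms(3) in \<open>fastforce simp: le_max_iff_disj\<close>)+
qed

lemma test_functions_bounded:
  assumes "f \<in> test_functions \<Omega>"
  obtains M where "M \<ge> 0" "\<And>x. \<bar>f x\<bar> \<le> M" "\<And>x. norm (grad f x) \<le> M"
proof -
  obtain K where K: "smooth f" "compact K" "\<And>x. x \<notin> K \<Longrightarrow> f x = 0" "\<And>x. x \<notin> K \<Longrightarrow> grad f x = 0"
    using test_functionsE[OF assms] by metis
  obtain M where M: "\<And>x. norm (f x) \<le> M"
    using compact_support_bounded[OF smooth_imp_continuous[OF K(1)] K(2,3)] by blast
  obtain M' where M': "\<And>x. norm (grad f x) \<le> M'"
    using compact_support_bounded[OF continuous_grad[OF K(1)] K(2,4)] by blast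
  show ?thesis
  proof (rule that[of "max (max M M') 0"])
    show "\<bar>f x\<bar> \<le> max (max M M') 0" for x using M[of x] by auto
    show "norm (grad f x) \<le> max (max M M') 0" for x using M'[of x] by linarith
  qed simp
qed

lemma integrable_compact_support:
  fixes f :: "real ^ 'n \<Rightarrow> real"
  assumes "continuous_on UNIV f" "compact K" "\<And>x. x \<notin> K \<Longrightarrow> f x = 0"
  shows "integrable lborel f"
proof -
  have "integrable lborel (\<lambda>x. indicator K x *\<^sub>R f x)"
    by (rule borel_integrable_compact) (use assms continuous_on_subset in blast)+
  moreover have "(\<lambda>x. indicator K x *\<^sub>R f x) = f" using assms(3) by (force simp: indicator_def)
  ultimately show ?thesis by simp
qed

lemma lborel_integral_shift:
  fixes f :: "real ^ 'n \<Rightarrow> real"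
  assumes "integrable lborel f"
  shows "integrable lborel (\<lambda>x. f (x + c))" "(LINT x|lborel. f (x + c)) = (LINT x|lborel. f x)"
proof -
  have m: "f \<in> borel_measurable borel" using assms by (simp add: borel_measurable_integrable)
  have e: "distr lborel borel ((+) c) = lborel" by (rule lborel_distr_plus)
  have "(LINT x|lborel. f (x + c)) = (LINT x|distr lborel borel ((+) c). f x)"
    using m by (subst integral_distr) (auto simp: add.commute)
  then show "(LINT x|lborel. f (x + c)) = (LINT x|lborel. f x)" by (simp only: e)
  have "integrable (distr lborel borel ((+) c)) f" using assms e by simp
  then show "integrable lborel (\<lambda>x. f (x + c))"
    using m by (subst (asm) integrable_distr_eq) (auto simp: add.commute)
qed

text \<open>Difference quotients in a coordinate direction have integral zero by translation invariance.
  They converge to the partial derivative and, by the mean value theorem, are bounded by a constant on a fixed ball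
  and vanish outside it; so dominated convergence applies.\<close>

lemma integral_grad_eq_0:
  fixes f :: "real ^ 'n \<Rightarrow> real"
  assumes "smooth f" "compact K" "\<And>x. x \<notin> K \<Longrightarrow> f x = 0" "\<And>x. x \<notin> K \<Longrightarrow> grad f x = 0"
  shows "(LINT x|lborel. grad f x $ i) = 0"
proof -
  let ?e = "axis i 1 :: real ^ 'n"
  define q where "q n x = (f (x + inverse (real (Suc n)) *\<^sub>R ?e) - f x) / inverse (real (Suc n))" for n x
  have cf: "continuous_on UNIV f" by (rule smooth_imp_continuous[OF assms(1)])
  have intf: "integrable lborel f" by (rule integrable_compact_support[OF cf assms(2,3)])
  obtain R where "\<And>x. x \<in> K \<Longrightarrow> norm x \<le> R"
    using compact_imp_bounded[OF assms(2)] unfolding bounded_iff by auto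
  then have R: "K \<subseteq> cball 0 R" by auto
  obtain M where M: "M \<ge> 0" "\<And>x. norm (grad f x) \<le> M"
    using compact_support_bounded[OF continuous_grad[OF assms(1)] assms(2,4)] by blast
  have dir: "((\<lambda>t. f (x + t *\<^sub>R ?e)) has_real_derivative grad f (x + t *\<^sub>R ?e) $ i) (at t)" for x t
  proof -
    have "((\<lambda>t. f (x + t *\<^sub>R ?e)) has_derivative (\<lambda>h. grad f (x + t *\<^sub>R ?e) \<bullet> (h *\<^sub>R ?e))) (at t)"
      by (rule has_derivative_compose[OF _ has_derivative_grad[OF smooth_imp_differentiable[OF assms(1)]]])
        (auto intro!: derivative_eq_intros)
    then show ?thesis by (simp add: has_field_derivative_def inner_axis mult.commute[of _ "grad f _ $ i"] mult_commute_abs)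
  qed
  have lim: "(\<lambda>n. q n x) \<longlonglongrightarrow> grad f x $ i" for x
  proof -
    have "((\<lambda>h. (f (x + h *\<^sub>R ?e) - f x) / h) \<longlongrightarrow> grad f x $ i) (at 0)"
      using dir[of x 0] by (simp add: has_field_derivative_iff)
    then show ?thesis unfolding q_def
      by (rule filterlim_compose)
        (auto simp: filterlim_at LIMSEQ_inverse_real_of_nat simp del: of_nat_Suc)
  qed
  have bnd: "norm (q n x) \<le> M * indicator (cball 0 (R + 1)) x" for n x
  proof (cases "x \<in> cball 0 (R + 1)")
    case True
    define d where "d = inverse (real (Suc n))"
    have d: "d > 0" by (simp add: d_def)
    obtain z where "0 < z" "z < d" "f (x + d *\<^sub>R ?e) - f (x + 0 *\<^sub>R ?e) = (d - 0) * (grad f (x + z *\<^sub>R ?e) $ i)"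
      using MVT2[OF d dir] by blast
    then have "q n x = grad f (x + z *\<^sub>R ?e) $ i" using d unfolding q_def d_def[symmetric] by simp
    then show ?thesis using True M component_le_norm_cart order_trans by fastforce
  next
    case False
    have "norm (inverse (real (Suc n)) *\<^sub>R ?e) \<le> 1"
      by (simp add: norm_axis_1 field_simps)
    then have "x + inverse (real (Suc n)) *\<^sub>R ?e \<notin> cball 0 R" "x \<notin> cball 0 R"
      using False norm_triangle_ineq4[of "x + inverse (real (Suc n)) *\<^sub>R ?e" "inverse (real (Suc n)) *\<^sub>R ?e"]
      by auto
    then have "x + inverse (real (Suc n)) *\<^sub>R ?e \<notin> K" "x \<notin> K" using R by blast+
    then show ?thesis using False assms(3) by (simp add: q_def)
  qed
  have int0: "(LINT x|lborel. q n x) = 0" for n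
    unfolding q_def using lborel_integral_shift[OF intf] intf by simp
  have "(\<lambda>n. LINT x|lborel. q n x) \<longlonglongrightarrow> (LINT x|lborel. grad f x $ i)"
  proof (rule integral_dominated_convergence[where w = "\<lambda>x. M * indicator (cball 0 (R + 1)) x"])
    show "(\<lambda>x. grad f x $ i) \<in> borel_measurable lborel"
      using smooth_imp_continuous[OF smooth_grad[OF assms(1)]] by (simp add: borel_measurable_continuous_onI)
    have "continuous_on UNIV (q n)" for n unfolding q_def
      by (intro continuous_intros continuous_on_compose2[OF cf]) auto
    then show "q n \<in> borel_measurable lborel" for n by (simp add: borel_measurable_continuous_onI)
    show "integrable lborel (\<lambda>x. M * indicator (cball 0 (R + 1)) x)"
      by (intro integrable_mult_right integrable_real_indicator) (auto intro: emeasure_bounded_finite[simplified])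
  qed (use lim bnd in auto)
  then show ?thesis using int0 by (simp add: LIMSEQ_const_iff)
qed

lemma lebesgue_on_eq_lborel_integral:
  fixes f :: "real ^ 'n \<Rightarrow> real"
  assumes "\<Omega> \<in> sets lebesgue" "f \<in> borel_measurable borel" "\<And>x. x \<notin> \<Omega> \<Longrightarrow> f x = 0"
  shows "(LINT x|lebesgue_on \<Omega>. f x) = (LINT x|lborel. f x)"
proof -
  have "(\<lambda>x. if x \<in> \<Omega> then f x else 0) = f" using assms(3) by auto
  then show ?thesis
    using Lebesgue_Measure.integral_restrict_UNIV[OF assms(1), of f] integral_completion[of f lborel] assms(2) by simp
qed

lemma integral_lebesgue_on_grad_eq_0:
  assumes "\<Omega> \<in> sets lebesgue" "f \<in> test_functions \<Omega>"
  shows "(LINT x|lebesgue_on \<Omega>. grad f x $ i) = 0"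
proof -
  obtain K where K: "smooth f" "compact K" "K \<subseteq> \<Omega>" "\<And>x. x \<notin> K \<Longrightarrow> f x = 0" "\<And>x. x \<notin> K \<Longrightarrow> grad f x = 0"
    using test_functionsE[OF assms(2)] by metis
  have "(LINT x|lebesgue_on \<Omega>. grad f x $ i) = (LINT x|lborel. grad f x $ i)"
  proof (intro lebesgue_on_eq_lborel_integral assms(1))
    show "(\<lambda>x. grad f x $ i) \<in> borel_measurable borel"
      using smooth_imp_continuous[OF smooth_grad[OF K(1)]] by (rule borel_measurable_continuous_onI)
    show "grad f x $ i = 0" if "x \<notin> \<Omega>" for x
    proof -
      have "x \<notin> K" using that K(3) by blast
      then show ?thesis by (simp add: K(5))
    qed
  qed
  then show ?thesis using integral_grad_eq_0[OF K(1,2,4,5)] by simp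
qed

section \<open>The fundamental lemma of the calculus of variations\<close>

text \<open>Since \<open>flat(m t)\<close> tends to \<open>1\<close> for \<open>t > 0\<close> and vanishes otherwise, products over the coordinates
  approximate the indicator function of an open box from inside.\<close>

lemma box_bump:
  fixes a b :: "real ^ 'n"
  assumes "cbox a b \<subseteq> \<Omega>"
  obtains \<psi> :: "nat \<Rightarrow> real ^ 'n \<Rightarrow> real" where
    "\<And>m. \<psi> m \<in> test_functions \<Omega>"
    "\<And>m x. \<bar>\<psi> m x\<bar> \<le> indicator (cbox a b) x"
    "\<And>x. (\<lambda>m. \<psi> m x) \<longlonglongrightarrow> indicator (box a b) x"
proof
  define \<psi> where "\<psi> m x = (\<Prod>i\<in>UNIV. flat (real m * (x $ i - a $ i)) * flat (real m * (b $ i - x $ i)))"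
    for m and x :: "real ^ 'n"
  have 0: "\<psi> m x = 0" if xb: "x \<notin> box a b" for m x
  proof -
    obtain i where "\<not> (a $ i < x $ i \<and> x $ i < b $ i)" using xb unfolding mem_box_cart by blast
    then have "flat (real m * (x $ i - a $ i)) * flat (real m * (b $ i - x $ i)) = 0"
      by (auto simp: flat_eq_0_iff mult_nonneg_nonpos)
    then show ?thesis unfolding \<psi>_def by (meson UNIV_I finite prod_zero)
  qed
  show "\<psi> m \<in> test_functions \<Omega>" for m
  proof (rule test_functionsI[OF _ compact_cbox assms])
    have 1: "C_k k (\<lambda>x. flat (real m * (x $ i - a $ i)))" for k i
      using C_k_compose[OF smooth_real_affine[OF smooth_flat, of 0 1 "real m" "- real m * a $ i"] C_k_component[of k i]]
      by (simp add: algebra_simps)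
    have 2: "C_k k (\<lambda>x. flat (real m * (b $ i - x $ i)))" for k i
      using C_k_compose[OF smooth_real_affine[OF smooth_flat, of 0 1 "- real m" "real m * b $ i"] C_k_component[of k i]]
      by (simp add: algebra_simps)
    show "smooth (\<psi> m)" unfolding smooth_def \<psi>_def by (intro allI C_k_prod C_k_mult 1 2)
    show "\<psi> m x = 0" if "x \<notin> cbox a b" for x using 0 that box_subset_cbox by blast
  qed
  show "\<bar>\<psi> m x\<bar> \<le> indicator (cbox a b) x" for m x
  proof (cases "x \<in> cbox a b")
    case True
    have "0 \<le> \<psi> m x" "\<psi> m x \<le> 1" unfolding \<psi>_def
      by (auto intro!: prod_nonneg prod_le_1 mult_le_one simp: flat_nonneg flat_le_1)
    then show ?thesis using True by simp
  next
    case False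
    then have "x \<notin> box a b" using box_subset_cbox by blast
    then show ?thesis using False 0 by simp
  qed
  show "(\<lambda>m. \<psi> m x) \<longlonglongrightarrow> indicator (box a b) x" for x
  proof (cases "x \<in> box a b")
    case True
    have lim: "(\<lambda>m. flat (real m * t)) \<longlonglongrightarrow> 1" if "t > 0" for t
    proof -
      have "(\<lambda>m. exp (- (inverse t * inverse (real m)))) \<longlonglongrightarrow> exp (- (inverse t * 0))"
        by (intro tendsto_intros lim_inverse_n)
      then have "(\<lambda>m. exp (- (inverse t * inverse (real m)))) \<longlonglongrightarrow> 1" by simp
      moreover have "\<forall>\<^sub>F m in sequentially. exp (- (inverse t * inverse (real m))) = flat (real m * t)"
        using eventually_gt_at_top[of 0] by eventually_elim (use that in \<open>simp add: flat_def field_simps\<close>)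
      ultimately show ?thesis by (rule Lim_transform_eventually)
    qed
    have "(\<lambda>m. \<psi> m x) \<longlonglongrightarrow> (\<Prod>i\<in>(UNIV :: 'n set). 1 * 1)" unfolding \<psi>_def
      by (intro tendsto_prod tendsto_mult lim) (use True in \<open>auto simp: mem_box_cart\<close>)
    then show ?thesis using True by simp
  qed (simp add: 0)
qed

text \<open>Boxes form an intersection-stable generator of the Borel sets, so the
  integrals over all Borel sets vanish; then a Borel representative of \<open>g\<close> vanishes almost everywhere.\<close>

lemma integrable_lebesgue_box_integrals_eq_0:
  fixes g :: "real ^ 'n \<Rightarrow> real"
  assumes g: "integrable lebesgue g" and U: "integral\<^sup>L lebesgue g = 0"
    and 0: "\<And>c d. (LINT x|lebesgue. indicator (box c d) x * g x) = 0"
  shows "AE x in lebesgue. g x = 0"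
proof -
  have ind: "integrable lebesgue (\<lambda>x. indicator A x * g x)" if "A \<in> sets borel" for A
    using integrable_mult_indicator[OF _ g, of A] that by simp
  have Z: "(LINT x|lebesgue. indicator A x * g x) = 0" if "A \<in> sets borel" for A
  proof -
    let ?G = "range (\<lambda>(a, b). box a b) :: (real ^ 'n) set set"
    have bs: "sets (borel :: (real ^ 'n) measure) = sigma_sets UNIV ?G"
      by (subst borel_eq_box) (simp add: sets_measure_of)
    have "Int_stable ?G"
      by (auto simp: Int_stable_def box_Int_box image_iff)
    moreover have "?G \<subseteq> Pow UNIV" by simp
    moreover have "A \<in> sigma_sets UNIV ?G" using that bs by simp
    ultimately show ?thesis
    proof (induction rule: sigma_sets_induct_disjoint)
      case (basic A) then show ?case using 0 by auto
    next
      case empty then show ?case by simp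
    next
      case (compl A)
      then have A: "A \<in> sets borel" using bs by simp
      have "(LINT x|lebesgue. indicator (UNIV - A) x * g x) = (LINT x|lebesgue. g x - indicator A x * g x)"
        by (intro Bochner_Integration.integral_cong) (auto simp: indicator_def)
      also have "\<dots> = 0" using ind[OF A] g U compl by simp
      finally show ?case .
    next
      case (union A)
      then have A: "A i \<in> sets lebesgue" for i using bs by (metis sets_completionI_sets sets_lborel UNIV_I image_subset_iff)
      have "set_lebesgue_integral lebesgue (\<Union>i. A i) g = (\<Sum>i. set_lebesgue_integral lebesgue (A i) g)"
        using union(1) A g
        by (intro lebesgue_integral_countable_add)
          (auto simp: disjoint_family_on_def set_integrable_def intro!: integrable_mult_indicator[OF _ g, simplified])
      then show ?case using union by (simp add: set_lebesgue_integral_def)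
    qed
  qed
  obtain g' where g': "g' \<in> borel_measurable lborel" "AE x in lborel. g x = g' x"
    using completion_ex_borel_measurable_real[of g lborel] borel_measurable_integrable[OF g] by auto
  have g'L: "AE x in lebesgue. g x = g' x" using g'(2) by (rule AE_completion)
  have m: "g' \<in> borel_measurable lebesgue" using g'(1) by (rule measurable_completion)
  have "integrable lebesgue g'"
    using integrable_cong_AE[THEN iffD1, OF _ m g'L g] g by (simp add: borel_measurable_integrable)
  then have ig': "integrable lborel g'" using g'(1) integrable_completion by blast
  have "AE x in lborel. g' x = 0"
  proof (rule density_unique_real[OF ig'])
    fix A :: "(real ^ 'n) set" assume A: "A \<in> sets lborel"
    then have AL: "A \<in> sets lebesgue" by (rule sets_completionI_sets)
    have "(LINT x|lborel. indicator A x * g' x) = (LINT x|lebesgue. indicator A x * g' x)"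
      using A g'(1) by (subst integral_completion) auto
    also have "\<dots> = (LINT x|lebesgue. indicator A x * g x)"
      using g'L m AL borel_measurable_integrable[OF g] by (intro integral_cong_AE) auto
    also have "\<dots> = 0" using Z A by simp
    finally show "set_lebesgue_integral lborel A g' = set_lebesgue_integral lborel A (\<lambda>_. 0)"
      by (simp add: set_lebesgue_integral_def)
  qed simp
  then have "AE x in lebesgue. g' x = 0" by (rule AE_completion)
  with g'L show ?thesis by eventually_elim simp
qed

text \<open>Testing with the bump functions of a box shows that \<open>f\<close> has integral zero over every
  box whose closure lies in \<open>\<Omega>\<close>. Hence \<open>f\<close> vanishes almost everywhere in each such box, and countably many of them
  cover \<open>\<Omega>\<close>.\<close>

lemma fundamental_lemma_calculus_of_variations:
  fixes f :: "real ^ 'n \<Rightarrow> real"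
  assumes \<Omega>: "open \<Omega>" and f: "f \<in> L1_loc \<Omega>"
    and 0: "\<And>\<psi>. \<psi> \<in> test_functions \<Omega> \<Longrightarrow> (LINT x|lebesgue_on \<Omega>. f x * \<psi> x) = 0"
  shows "AE x in lebesgue_on \<Omega>. f x = 0"
proof -
  have \<Omega>L: "\<Omega> \<in> sets lebesgue" using \<Omega> by auto
  have fi: "integrable lebesgue (\<lambda>x. indicator (cbox a b) x * f x)" if "cbox a b \<subseteq> \<Omega>" for a b
    using f that by (auto simp: L1_loc_def set_integrable_def)
  have fb: "integrable lebesgue (\<lambda>x. indicator (box a b) x * f x)" if "cbox a b \<subseteq> \<Omega>" for a b
  proof -
    have "integrable lebesgue (\<lambda>x. indicator (box a b) x *\<^sub>R (indicator (cbox a b) x * f x))"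
      using fi[OF that] by (intro integrable_mult_indicator) auto
    moreover have "(\<lambda>x. indicator (box a b) x *\<^sub>R (indicator (cbox a b) x * f x)) = (\<lambda>x. indicator (box a b) x * f x)"
      using box_subset_cbox by (fastforce simp: indicator_def)
    ultimately show ?thesis by simp
  qed
  have box0: "(LINT x|lebesgue. indicator (box a b) x * f x) = 0" if ab: "cbox a b \<subseteq> \<Omega>" for a b
  proof -
    obtain \<psi> where \<psi>: "\<And>m. \<psi> m \<in> test_functions \<Omega>"
      "\<And>m x. \<bar>\<psi> m x\<bar> \<le> indicator (cbox a b) x"
      "\<And>x. (\<lambda>m. \<psi> m x) \<longlonglongrightarrow> indicator (box a b) x"
      using box_bump[OF ab] by metis
    have out: "\<psi> m x = 0" if "x \<notin> cbox a b" for m x using \<psi>(2)[of m x] that by simp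
    have out': "\<psi> m x = 0" if "x \<notin> \<Omega>" for m x using out that ab by blast
    have eq: "(LINT x|lebesgue. \<psi> m x * f x) = 0" for m
    proof -
      have "(\<lambda>x. if x \<in> \<Omega> then f x * \<psi> m x else 0) = (\<lambda>x. \<psi> m x * f x)" using out' by auto
      then show ?thesis using 0[OF \<psi>(1)] Lebesgue_Measure.integral_restrict_UNIV[OF \<Omega>L, of "\<lambda>x. f x * \<psi> m x"] by simp
    qed
    have "(\<lambda>m. LINT x|lebesgue. \<psi> m x * f x) \<longlonglongrightarrow> (LINT x|lebesgue. indicator (box a b) x * f x)"
    proof (rule integral_dominated_convergence[where w = "\<lambda>x. norm (indicator (cbox a b) x * f x)"])
      show "(\<lambda>x. indicator (box a b) x * f x) \<in> borel_measurable lebesgue"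
        using fb[OF ab] by (rule borel_measurable_integrable)
      show "(\<lambda>x. \<psi> m x * f x) \<in> borel_measurable lebesgue" for m
      proof -
        have "\<psi> m \<in> borel_measurable borel"
          using smooth_imp_continuous[OF test_functions_smooth[OF \<psi>(1)]] by (rule borel_measurable_continuous_onI)
        then have "\<psi> m \<in> borel_measurable lebesgue" by (intro measurable_completion) simp
        then have "(\<lambda>x. \<psi> m x * (indicator (cbox a b) x * f x)) \<in> borel_measurable lebesgue"
          using borel_measurable_integrable[OF fi[OF ab]] by (rule borel_measurable_times)
        moreover have "(\<lambda>x. \<psi> m x * (indicator (cbox a b) x * f x)) = (\<lambda>x. \<psi> m x * f x)"
          using out by (fastforce simp: indicator_def)
        ultimately show ?thesis by simp
      qed
      show "AE x in lebesgue. norm (\<psi> m x * f x) \<le> norm (indicator (cbox a b) x * f x)" for m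
        using \<psi>(2) by (auto simp: abs_mult intro!: mult_right_mono)
      show "AE x in lebesgue. (\<lambda>m. \<psi> m x * f x) \<longlonglongrightarrow> indicator (box a b) x * f x"
        using \<psi>(3) by (auto intro!: tendsto_mult)
    qed (use fi[OF ab] in auto)
    then show ?thesis using eq by (simp add: LIMSEQ_const_iff)
  qed
  have ae: "AE x in lebesgue. x \<in> cbox a b \<longrightarrow> f x = 0" if ab: "cbox a b \<subseteq> \<Omega>" for a b
  proof -
    have "AE x in lebesgue. indicator (box a b) x * f x = 0"
    proof (rule integrable_lebesgue_box_integrals_eq_0[OF fb[OF ab] box0[OF ab]])
      fix c d :: "real ^ 'n"
      obtain p q where pq: "box c d \<inter> box a b = box p q" "cbox c d \<inter> cbox a b = cbox p q"
        by (rule that[OF box_Int_box Int_interval])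
      have "(\<lambda>x. indicator (box c d) x * (indicator (box a b) x * f x)) = (\<lambda>x. indicator (box p q) x * f x)"
        unfolding pq(1)[symmetric] by (auto simp: indicator_def)
      moreover have "cbox p q \<subseteq> \<Omega>" using pq(2) ab by blast
      ultimately show "(LINT x|lebesgue. indicator (box c d) x * (indicator (box a b) x * f x)) = 0"
        using box0 by simp
    qed
    moreover have "AE x in lebesgue. x \<notin> cbox a b - box a b"
      using negligible_frontier_interval[of a b] AE_not_in unfolding negligible_iff_null_sets by blast
    ultimately show ?thesis by eventually_elim auto
  qed
  obtain \<D> where \<D>: "countable \<D>" "\<D> \<subseteq> Pow \<Omega>" "\<And>X. X \<in> \<D> \<Longrightarrow> \<exists>a b. X = cbox a b" "\<Union>\<D> = \<Omega>"
    using open_countable_Union_open_cbox[OF \<Omega>] by metis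
  have "AE x in lebesgue. \<forall>X\<in>\<D>. x \<in> X \<longrightarrow> f x = 0"
  proof (subst AE_ball_countable[OF \<D>(1)], intro ballI)
    fix X assume "X \<in> \<D>"
    then obtain a b where "X = cbox a b" "X \<subseteq> \<Omega>" using \<D> by blast
    then show "AE x in lebesgue. x \<in> X \<longrightarrow> f x = 0" using ae by simp
  qed
  then have "AE x in lebesgue. x \<in> \<Omega> \<longrightarrow> f x = 0" by eventually_elim (use \<D>(4) in blast)
  then show ?thesis using \<Omega>L by (subst AE_restrict_space_iff) auto
qed

section \<open>Square integrable functions\<close>

definition L2 :: "'a measure \<Rightarrow> ('a \<Rightarrow> 'b::euclidean_space) \<Rightarrow> bool" where
  "L2 M f \<longleftrightarrow> f \<in> borel_measurable M \<and> integrable M (\<lambda>x. (norm (f x))\<^sup>2)"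

definition L2_conv :: "'a measure \<Rightarrow> (nat \<Rightarrow> 'a \<Rightarrow> 'b::euclidean_space) \<Rightarrow> ('a \<Rightarrow> 'b) \<Rightarrow> bool" where
  "L2_conv M a f \<longleftrightarrow> (\<forall>n. L2 M (a n)) \<and> L2 M f \<and> (\<lambda>n. LINT x|M. (norm (a n x - f x))\<^sup>2) \<longlonglongrightarrow> 0"

lemma L2_measurable [measurable_dest]: "L2 M f \<Longrightarrow> f \<in> borel_measurable M"
  by (simp add: L2_def)

lemma L2_norm_sq: "L2 M f \<Longrightarrow> integrable M (\<lambda>x. (norm (f x))\<^sup>2)"
  by (simp add: L2_def)

lemma norm_add_sq_le: "(norm (x + y :: 'b::euclidean_space))\<^sup>2 \<le> 2 * (norm x)\<^sup>2 + 2 * (norm y)\<^sup>2"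
proof -
  have "(norm (x + y))\<^sup>2 \<le> (norm x + norm y)\<^sup>2" by (simp add: norm_triangle_ineq power_mono)
  also have "\<dots> \<le> 2 * (norm x)\<^sup>2 + 2 * (norm y)\<^sup>2"
    using sum_squares_bound[of "norm x" "norm y"] by (simp add: power2_sum)
  finally show ?thesis .
qed

lemma L2_bound:
  assumes "L2 M g" "f \<in> borel_measurable M" "AE x in M. norm (f x) \<le> C * norm (g x)"
  shows "L2 M f"
proof -
  have "AE x in M. norm ((norm (f x))\<^sup>2) \<le> norm (C\<^sup>2 * (norm (g x))\<^sup>2)"
    using assms(3) by eventually_elim (simp add: power_mono flip: power_mult_distrib)
  moreover have "integrable M (\<lambda>x. C\<^sup>2 * (norm (g x))\<^sup>2)" using assms(1) by (simp add: L2_def)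
  moreover have "(\<lambda>x. (norm (f x))\<^sup>2) \<in> borel_measurable M" using assms(2) by measurable
  ultimately show ?thesis unfolding L2_def using assms(2) Bochner_Integration.integrable_bound by blast
qed

lemma L2_bounded_scaleR:
  assumes "L2 M f" "w \<in> borel_measurable M" "AE x in M. \<bar>w x\<bar> \<le> C"
  shows "L2 M (\<lambda>x. w x *\<^sub>R f x)"
proof (rule L2_bound[OF assms(1)])
  show "(\<lambda>x. w x *\<^sub>R f x) \<in> borel_measurable M"
    using assms(2) L2_measurable[OF assms(1)] by (rule borel_measurable_scaleR)
  show "AE x in M. norm (w x *\<^sub>R f x) \<le> C * norm (f x)"
    using assms(3) by eventually_elim (simp add: mult_right_mono)
qed

lemma L2_mult_bounded:
  "L2 M f \<Longrightarrow> w \<in> borel_measurable M \<Longrightarrow> (\<And>x. \<bar>w x\<bar> \<le> C) \<Longrightarrow> L2 M (\<lambda>x. w x *\<^sub>R f x)"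
  by (rule L2_bounded_scaleR) auto

lemma L2_scaleR: "L2 M f \<Longrightarrow> L2 M (\<lambda>x. c *\<^sub>R f x)"
  by (rule L2_bounded_scaleR[where C = "\<bar>c\<bar>"]) auto

lemma L2_add:
  assumes "L2 M f" "L2 M g"
  shows "L2 M (\<lambda>x. f x + g x)"
proof -
  have m: "f \<in> borel_measurable M" "g \<in> borel_measurable M" using assms by (auto dest: L2_measurable)
  have "integrable M (\<lambda>x. (norm (f x + g x))\<^sup>2)"
    by (rule Bochner_Integration.integrable_bound[where f = "\<lambda>x. 2 * (norm (f x))\<^sup>2 + 2 * (norm (g x))\<^sup>2"])
      (use assms m norm_add_sq_le in \<open>auto simp: L2_def\<close>)
  then show ?thesis using m by (simp add: L2_def)
qed

lemma L2_sum:
  assumes "finite I" "\<And>i. i \<in> I \<Longrightarrow> L2 M (f i)"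
  shows "L2 M (\<lambda>x. \<Sum>i\<in>I. f i x)"
  using assms
proof (induction rule: finite_induct)
  case empty
  show ?case by (simp add: L2_def)
qed (simp add: L2_add)

lemma L2_diff:
  assumes "L2 M f" "L2 M g" shows "L2 M (\<lambda>x. f x - g x)"
  using L2_add[OF assms(1) L2_scaleR[OF assms(2), of "-1"]] by simp

lemma borel_measurable_component:
  fixes f :: "'a \<Rightarrow> real ^ 'n"
  assumes "f \<in> borel_measurable M"
  shows "(\<lambda>x. f x $ i) \<in> borel_measurable M"
  by (rule measurable_compose[OF assms borel_measurable_continuous_onI])
    (intro continuous_intros)

lemma L2_component:
  fixes f :: "'a \<Rightarrow> real ^ 'n"
  assumes "L2 M f"
  shows "L2 M (\<lambda>x. f x $ i)"
  by (rule L2_bound[where C = 1, OF assms borel_measurable_component[OF L2_measurable[OF assms]]])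
    (simp add: component_le_norm_cart)

lemma L2_norm_mult_integrable:
  assumes "L2 M f" "L2 M g" shows "integrable M (\<lambda>x. norm (f x) * norm (g x))"
proof (rule Bochner_Integration.integrable_bound[where f = "\<lambda>x. (norm (f x))\<^sup>2 + (norm (g x))\<^sup>2"])
  have "norm a * norm b \<le> (norm a)\<^sup>2 + (norm b)\<^sup>2" for a :: 'b and b :: 'c
    using sum_squares_bound[of "norm a" "norm b"] mult_nonneg_nonneg[OF norm_ge_zero[of a] norm_ge_zero[of b]]
    unfolding mult.assoc by linarith
  then show "AE x in M. norm (norm (f x) * norm (g x)) \<le> norm ((norm (f x))\<^sup>2 + (norm (g x))\<^sup>2)" by auto
qed (use assms in \<open>auto simp: L2_def\<close>)

lemma L2_inner_integrable:
  assumes "L2 M f" "L2 M g" shows "integrable M (\<lambda>x. f x \<bullet> g x)"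
  by (rule Bochner_Integration.integrable_bound[OF L2_norm_mult_integrable[OF assms]])
    (use assms in \<open>auto dest: L2_measurable simp: Cauchy_Schwarz_ineq2\<close>)

lemma L2_scaleR_integrable:
  assumes "L2 M f" "L2 M g" shows "integrable M (\<lambda>x. f x *\<^sub>R g x)"
  by (rule Bochner_Integration.integrable_bound[OF L2_norm_mult_integrable[OF assms]])
    (use assms in \<open>auto dest: L2_measurable\<close>)

lemma L2_mult_integrable:
  fixes f g :: "'a \<Rightarrow> real"
  assumes "L2 M f" "L2 M g" shows "integrable M (\<lambda>x. f x * g x)"
  using L2_scaleR_integrable[OF assms] by simp

lemma (in finite_measure) L2_integrable:
  assumes "L2 M f" shows "integrable M f"
proof (rule Bochner_Integration.integrable_bound[where f = "\<lambda>x. 1 + (norm (f x))\<^sup>2"])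
  have "norm y \<le> 1 + (norm y)\<^sup>2" for y :: 'b
    using sum_squares_bound[of "norm y" 1] by (simp add: power2_eq_square) (smt (verit) norm_ge_zero)
  then show "AE x in M. norm (f x) \<le> norm (1 + (norm (f x))\<^sup>2)" by (auto intro: order_trans[OF _ abs_ge_self])
qed (use assms in \<open>auto simp: L2_def\<close>)

text \<open>Young's inequality with a free parameter; choosing the parameter along a sequence replaces the
  Cauchy--Schwarz inequality in the next lemma.\<close>

lemma L2_integral_inner_bound:
  assumes "L2 M f" "L2 M g" "e > 0"
  shows "2 * \<bar>LINT x|M. f x \<bullet> g x\<bar> \<le> e * (LINT x|M. (norm (f x))\<^sup>2) + (LINT x|M. (norm (g x))\<^sup>2) / e"
proof -
  have pt: "\<bar>a \<bullet> b\<bar> \<le> (e * (norm a)\<^sup>2 + (norm b)\<^sup>2 / e) / 2" for a b :: 'b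
  proof -
    have "0 \<le> (e * norm a - norm b)\<^sup>2 / e" using assms(3) by simp
    then have "2 * (norm a * norm b) \<le> e * (norm a)\<^sup>2 + (norm b)\<^sup>2 / e"
      using assms(3) by (simp add: power2_eq_square field_simps)
    then show ?thesis using Cauchy_Schwarz_ineq2[of a b] by simp
  qed
  have i: "integrable M (\<lambda>x. (e * (norm (f x))\<^sup>2 + (norm (g x))\<^sup>2 / e) / 2)"
    using assms by (auto simp: L2_def)
  have "\<bar>LINT x|M. f x \<bullet> g x\<bar> \<le> (LINT x|M. \<bar>f x \<bullet> g x\<bar>)"
    using integral_abs_bound by blast
  also have "\<dots> \<le> (LINT x|M. (e * (norm (f x))\<^sup>2 + (norm (g x))\<^sup>2 / e) / 2)"
    by (rule integral_mono) (use i pt L2_inner_integrable[OF assms(1,2)] in auto)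
  also have "\<dots> = (e * (LINT x|M. (norm (f x))\<^sup>2) + (LINT x|M. (norm (g x))\<^sup>2) / e) / 2"
    using assms by (simp add: L2_def)
  finally show ?thesis by simp
qed

lemma L2_conv_inner:
  assumes h: "L2 M h" and c: "L2_conv M a f"
  shows "(\<lambda>n. LINT x|M. h x \<bullet> a n x) \<longlonglongrightarrow> (LINT x|M. h x \<bullet> f x)"
proof -
  define H where "H = (LINT x|M. (norm (h x))\<^sup>2)"
  define B where "B n = (LINT x|M. (norm (a n x - f x))\<^sup>2)" for n
  \<comment> \<open>The summand \<open>1/(n+1)\<close> only keeps the parameter positive.\<close>
  define e where "e n = sqrt (B n) + inverse (real (Suc n))" for n
  have B0: "B n \<ge> 0" for n by (simp add: B_def)
  have Bl: "B \<longlonglongrightarrow> 0" using c by (simp add: L2_conv_def B_def[abs_def])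
  have L: "L2 M (a n)" "L2 M f" for n using c by (auto simp: L2_conv_def)
  have e0: "e n > 0" for n using B0[of n] by (simp add: e_def add_nonneg_pos)
  have el: "e \<longlonglongrightarrow> 0"
    using tendsto_add[OF tendsto_real_sqrt[OF Bl] LIMSEQ_inverse_real_of_nat] by (simp add: e_def[abs_def])
  have bd: "\<bar>(LINT x|M. h x \<bullet> a n x) - (LINT x|M. h x \<bullet> f x)\<bar> \<le> e n * H + e n" for n
  proof -
    have "(LINT x|M. h x \<bullet> a n x) - (LINT x|M. h x \<bullet> f x) = (LINT x|M. h x \<bullet> (a n x - f x))"
      using L2_inner_integrable[OF h] L by (simp add: inner_diff_right)
    moreover have "2 * \<bar>LINT x|M. h x \<bullet> (a n x - f x)\<bar> \<le> e n * H + B n / e n"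
      using L2_integral_inner_bound[OF h L2_diff[OF L] e0] by (simp add: H_def B_def)
    moreover have "B n / e n \<le> e n"
    proof -
      have "B n = (sqrt (B n))\<^sup>2" using B0 by simp
      also have "\<dots> \<le> (e n)\<^sup>2" by (rule power_mono) (auto simp: e_def B0)
      finally show ?thesis using e0[of n] by (simp add: divide_le_eq power2_eq_square)
    qed
    moreover have "0 \<le> e n * H" using e0[of n] by (simp add: H_def)
    ultimately show ?thesis using e0[of n] by linarith
  qed
  have "(\<lambda>n. e n * H + e n) \<longlonglongrightarrow> 0 * H + 0" by (intro tendsto_intros el)
  then have "(\<lambda>n. e n * H + e n) \<longlonglongrightarrow> 0" by simp
  then have "(\<lambda>n. (LINT x|M. h x \<bullet> a n x) - (LINT x|M. h x \<bullet> f x)) \<longlonglongrightarrow> 0"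
    by (rule Lim_null_comparison[rotated]) (use bd in auto)
  then show ?thesis by (simp add: LIM_zero_iff)
qed

lemma L2_conv_AE_subseq:
  assumes "L2_conv M a f"
  obtains r where "strict_mono r" "AE x in M. (\<lambda>n. a (r n) x) \<longlonglongrightarrow> f x"
proof -
  have L: "L2 M (\<lambda>x. a n x - f x)" for n using assms by (auto simp: L2_conv_def intro: L2_diff)
  have "\<exists>r. strict_mono r \<and> (AE x in M. (\<lambda>n. (norm (a (r n) x - f x))\<^sup>2) \<longlonglongrightarrow> 0)"
    by (rule tendsto_L1_AE_subseq) (use assms L in \<open>auto simp: L2_conv_def L2_norm_sq\<close>)
  then obtain r where r: "strict_mono r" "AE x in M. (\<lambda>n. (norm (a (r n) x - f x))\<^sup>2) \<longlonglongrightarrow> 0" by auto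
  from r(2) have "AE x in M. (\<lambda>n. a (r n) x) \<longlonglongrightarrow> f x"
  proof eventually_elim
    case (elim x)
    from tendsto_real_sqrt[OF elim] show ?case by (simp add: tendsto_norm_zero_iff LIM_zero_iff)
  qed
  with r(1) that show ?thesis by blast
qed

lemma L2_conv_subseq: "L2_conv M a f \<Longrightarrow> strict_mono r \<Longrightarrow> L2_conv M (\<lambda>n. a (r n)) f"
  unfolding L2_conv_def using LIMSEQ_subseq_LIMSEQ[of "\<lambda>n. LINT x|M. (norm (a n x - f x))\<^sup>2" 0 r]
  by (auto simp: o_def)

lemma L2_conv_squeeze:
  assumes "\<And>n. L2 M (a n)" "L2 M f" "\<And>n. integrable M (b n)" "(\<lambda>n. LINT x|M. b n x) \<longlonglongrightarrow> 0"
    and "\<And>n. AE x in M. (norm (a n x - f x))\<^sup>2 \<le> b n x"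
  shows "L2_conv M a f"
proof -
  have "(\<lambda>n. LINT x|M. (norm (a n x - f x))\<^sup>2) \<longlonglongrightarrow> 0"
    by (rule Lim_null_comparison[OF _ assms(4)])
      (auto intro!: always_eventually integral_mono_AE assms L2_norm_sq L2_diff)
  then show ?thesis using assms by (simp add: L2_conv_def)
qed

lemma L2_conv_add:
  assumes "L2_conv M a f" "L2_conv M b g"
  shows "L2_conv M (\<lambda>n x. a n x + b n x) (\<lambda>x. f x + g x)"
proof (rule L2_conv_squeeze)
  let ?c = "\<lambda>n x. 2 * (norm (a n x - f x))\<^sup>2 + 2 * (norm (b n x - g x))\<^sup>2"
  have i: "integrable M (\<lambda>x. (norm (a n x - f x))\<^sup>2)" "integrable M (\<lambda>x. (norm (b n x - g x))\<^sup>2)" for n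
    using assms by (auto simp: L2_conv_def intro!: L2_norm_sq L2_diff)
  show "integrable M (?c n)" for n using i by auto
  have "(\<lambda>n. 2 * (LINT x|M. (norm (a n x - f x))\<^sup>2) + 2 * (LINT x|M. (norm (b n x - g x))\<^sup>2)) \<longlonglongrightarrow> 2 * 0 + 2 * 0"
    using assms by (intro tendsto_intros) (auto simp: L2_conv_def)
  then show "(\<lambda>n. LINT x|M. ?c n x) \<longlonglongrightarrow> 0" using i by simp
  show "AE x in M. (norm (a n x + b n x - (f x + g x)))\<^sup>2 \<le> ?c n x" for n
  proof (rule always_eventually, rule allI)
    fix x
    have "a n x + b n x - (f x + g x) = (a n x - f x) + (b n x - g x)" by simp
    then show "(norm (a n x + b n x - (f x + g x)))\<^sup>2 \<le> ?c n x" using norm_add_sq_le by metis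
  qed
qed (use assms in \<open>auto simp: L2_conv_def L2_add\<close>)

lemma L2_conv_scaleR:
  assumes "L2_conv M a f"
  shows "L2_conv M (\<lambda>n x. c *\<^sub>R a n x) (\<lambda>x. c *\<^sub>R f x)"
proof (rule L2_conv_squeeze)
  have i: "integrable M (\<lambda>x. (norm (a n x - f x))\<^sup>2)" for n
    using assms by (auto simp: L2_conv_def intro!: L2_norm_sq L2_diff)
  then show "integrable M (\<lambda>x. c\<^sup>2 * (norm (a n x - f x))\<^sup>2)" for n by auto
  show "(\<lambda>n. LINT x|M. c\<^sup>2 * (norm (a n x - f x))\<^sup>2) \<longlonglongrightarrow> 0"
    using assms by (auto simp: L2_conv_def intro!: tendsto_mult_right_zero)
  show "AE x in M. (norm (c *\<^sub>R a n x - c *\<^sub>R f x))\<^sup>2 \<le> c\<^sup>2 * (norm (a n x - f x))\<^sup>2" for n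
    by (simp add: power_mult_distrib flip: scaleR_diff_right)
qed (use assms in \<open>auto simp: L2_conv_def L2_scaleR\<close>)

lemma L_space_2_iff: "f \<in> L_space 2 \<Omega> \<longleftrightarrow> L2 (lebesgue_on \<Omega>) f"
proof -
  have "norm y powr 2 = (norm y)\<^sup>2" for y :: 'b by (cases "y = 0") auto
  then show ?thesis by (simp add: L_space_def L2_def)
qed

lemma L_space_1_iff: "f \<in> L_space 1 \<Omega> \<longleftrightarrow> integrable (lebesgue_on \<Omega>) f"
proof -
  have "integrable (lebesgue_on \<Omega>) (\<lambda>x. norm (f x)) \<and> f \<in> borel_measurable (lebesgue_on \<Omega>)
      \<longleftrightarrow> integrable (lebesgue_on \<Omega>) f"
    using integrable_norm_iff borel_measurable_integrable by blast
  then show ?thesis by (auto simp: L_space_def)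
qed

section \<open>Weak gradients and their uniqueness\<close>

lemma set_integrable_of_lebesgue_on:
  fixes f :: "real ^ 'n \<Rightarrow> 'b::euclidean_space"
  assumes "integrable (lebesgue_on \<Omega>) f" "\<Omega> \<in> sets lebesgue" "K \<in> sets lebesgue" "K \<subseteq> \<Omega>"
  shows "set_integrable lebesgue K f"
proof -
  have "integrable lebesgue (\<lambda>x. indicator K x *\<^sub>R (indicator \<Omega> x *\<^sub>R f x))"
    using assms(1,2) by (intro integrable_mult_indicator[OF assms(3)]) (simp add: integrable_restrict_space)
  moreover have "(\<lambda>x. indicator K x *\<^sub>R (indicator \<Omega> x *\<^sub>R f x)) = (\<lambda>x. indicator K x *\<^sub>R f x)"
    using assms(4) by (fastforce simp: indicator_def)
  ultimately show ?thesis by (simp add: set_integrable_def)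
qed

lemma continuous_measurable_lebesgue_on:
  fixes f :: "real ^ 'n \<Rightarrow> 'b::euclidean_space"
  assumes "continuous_on UNIV f"
  shows "f \<in> borel_measurable (lebesgue_on \<Omega>)"
  by (intro measurable_restrict_space1 measurable_completion)
    (simp add: borel_measurable_continuous_onI assms)

lemma borel_measurable_lebesgue_on_AE:
  fixes f g :: "real ^ 'n \<Rightarrow> 'b::euclidean_space"
  assumes "\<Omega> \<in> sets lebesgue" "f \<in> borel_measurable (lebesgue_on \<Omega>)" "AE x in lebesgue_on \<Omega>. f x = g x"
  shows "g \<in> borel_measurable (lebesgue_on \<Omega>)"
proof -
  have "AE x in lebesgue. x \<in> \<Omega> \<longrightarrow> f x = g x"
    using assms(1,3) by (subst (asm) AE_restrict_space_iff) auto
  then have "AE x in lebesgue. (if x \<in> \<Omega> then f x else 0) = (if x \<in> \<Omega> then g x else 0)"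
    by eventually_elim auto
  moreover have "(\<lambda>x. if x \<in> \<Omega> then f x else 0) \<in> borel_measurable lebesgue"
    using assms(1,2) by (simp add: borel_measurable_if)
  ultimately have "(\<lambda>x. if x \<in> \<Omega> then g x else 0) \<in> borel_measurable lebesgue"
    by (rule borel_measurable_AE[rotated])
  then show ?thesis by (rule borel_measurable_if_D)
qed

lemma L2_cong_AE:
  fixes f g :: "real ^ 'n \<Rightarrow> 'b::euclidean_space"
  assumes "\<Omega> \<in> sets lebesgue" "L2 (lebesgue_on \<Omega>) f" "AE x in lebesgue_on \<Omega>. f x = g x"
  shows "L2 (lebesgue_on \<Omega>) g"
proof (rule L2_bound[OF assms(2), where C = 1])
  show "g \<in> borel_measurable (lebesgue_on \<Omega>)"
    by (rule borel_measurable_lebesgue_on_AE[OF assms(1) L2_measurable[OF assms(2)] assms(3)])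
  show "AE x in lebesgue_on \<Omega>. norm (g x) \<le> 1 * norm (f x)"
    using assms(3) by eventually_elim simp
qed

lemma L1_loc_component:
  fixes g :: "real ^ 'n \<Rightarrow> real ^ 'n"
  assumes "g \<in> L1_loc \<Omega>" shows "(\<lambda>x. g x $ i) \<in> L1_loc \<Omega>"
proof -
  have "integrable lebesgue (\<lambda>x. indicator K x * g x $ i)" if "integrable lebesgue (\<lambda>x. indicator K x *\<^sub>R g x)" for K
    using integrable_bounded_linear[OF bounded_linear_vec_nth that, of i] by simp
  then show ?thesis using assms by (auto simp: L1_loc_def set_integrable_def)
qed

lemma L1_loc_diff:
  "f \<in> L1_loc \<Omega> \<Longrightarrow> g \<in> L1_loc \<Omega> \<Longrightarrow> (\<lambda>x. f x - g x) \<in> L1_loc \<Omega>"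
  unfolding L1_loc_def by (auto intro!: set_integral_diff)

lemma L1_loc_mult_test:
  fixes f :: "real ^ 'n \<Rightarrow> real"
  assumes "\<Omega> \<in> sets lebesgue" "f \<in> L1_loc \<Omega>" "\<psi> \<in> test_functions \<Omega>"
  shows "integrable (lebesgue_on \<Omega>) (\<lambda>x. f x * \<psi> x)"
proof -
  obtain K where K: "compact K" "K \<subseteq> \<Omega>" "\<And>x. x \<notin> K \<Longrightarrow> \<psi> x = 0"
    using test_functionsE[OF assms(3)] by metis
  obtain M where M: "M \<ge> 0" "\<And>x. \<bar>\<psi> x\<bar> \<le> M" using test_functions_bounded[OF assms(3)] by metis
  have i: "integrable lebesgue (\<lambda>x. indicator K x * f x)"
    using assms(2) K by (auto simp: L1_loc_def set_integrable_def)
  have m: "\<psi> \<in> borel_measurable lebesgue"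
    by (intro measurable_completion)
      (simp add: borel_measurable_continuous_onI smooth_imp_continuous test_functions_smooth[OF assms(3)])
  have "integrable lebesgue (\<lambda>x. (indicator K x * f x) * \<psi> x)"
  proof (rule Bochner_Integration.integrable_bound)
    show "integrable lebesgue (\<lambda>x. M * (indicator K x * f x))" using i by simp
    show "AE x in lebesgue. norm ((indicator K x * f x) * \<psi> x) \<le> norm (M * (indicator K x * f x))"
      using M by (simp add: abs_mult mult.commute mult_right_mono)
    show "(\<lambda>x. (indicator K x * f x) * \<psi> x) \<in> borel_measurable lebesgue"
      using borel_measurable_integrable[OF i] m by (rule borel_measurable_times)
  qed
  moreover have "(\<lambda>x. (indicator K x * f x) * \<psi> x) = (\<lambda>x. indicator \<Omega> x *\<^sub>R (f x * \<psi> x))"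
  proof
    fix x show "(indicator K x * f x) * \<psi> x = indicator \<Omega> x *\<^sub>R (f x * \<psi> x)"
      using K(2) K(3)[of x] by (cases "x \<in> K") auto
  qed
  ultimately show ?thesis using assms(1) by (simp add: integrable_restrict_space)
qed

text \<open>The components of \<open>g - g'\<close> annihilate all test functions.\<close>

lemma weak_grad_unique:
  assumes \<Omega>: "open \<Omega>" and u: "has_weak_grad \<Omega> u g" and v: "has_weak_grad \<Omega> v g'"
    and uv: "AE x in lebesgue_on \<Omega>. u x = v x"
  shows "AE x in lebesgue_on \<Omega>. g x = g' x"
proof -
  have \<Omega>L: "\<Omega> \<in> sets lebesgue" using \<Omega> by auto
  have loc: "(\<lambda>x. g x $ i) \<in> L1_loc \<Omega>" "(\<lambda>x. g' x $ i) \<in> L1_loc \<Omega>" for i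
    using u v by (auto simp: has_weak_grad_def intro: L1_loc_component)
  have "AE x in lebesgue_on \<Omega>. g x $ i - g' x $ i = 0" for i
  proof (rule fundamental_lemma_calculus_of_variations[OF \<Omega> L1_loc_diff[OF loc]])
    fix \<psi> assume \<psi>: "\<psi> \<in> test_functions \<Omega>"
    have m: "(\<lambda>x. u x * grad \<psi> x $ i) \<in> borel_measurable (lebesgue_on \<Omega>)"
            "(\<lambda>x. v x * grad \<psi> x $ i) \<in> borel_measurable (lebesgue_on \<Omega>)"
    proof -
      have "(\<lambda>x. grad \<psi> x $ i) \<in> test_functions \<Omega>"
        by (rule test_functionsE[OF \<psi>], rule test_functionsI) (auto intro: smooth_grad)
      then show "(\<lambda>x. u x * grad \<psi> x $ i) \<in> borel_measurable (lebesgue_on \<Omega>)"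
            "(\<lambda>x. v x * grad \<psi> x $ i) \<in> borel_measurable (lebesgue_on \<Omega>)"
        using u v L1_loc_mult_test[OF \<Omega>L] borel_measurable_integrable
        unfolding has_weak_grad_def by blast+
    qed
    have "(LINT x|lebesgue_on \<Omega>. u x * grad \<psi> x $ i) = (LINT x|lebesgue_on \<Omega>. v x * grad \<psi> x $ i)"
      by (rule integral_cong_AE[OF m]) (use uv in eventually_elim, simp)
    then have "(LINT x|lebesgue_on \<Omega>. g x $ i * \<psi> x) = (LINT x|lebesgue_on \<Omega>. g' x $ i * \<psi> x)"
      using u v \<psi> unfolding has_weak_grad_def by simp
    then show "(LINT x|lebesgue_on \<Omega>. (g x $ i - g' x $ i) * \<psi> x) = 0"
      using L1_loc_mult_test[OF \<Omega>L loc(1) \<psi>] L1_loc_mult_test[OF \<Omega>L loc(2) \<psi>]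
      by (simp add: left_diff_distrib)
  qed
  then have "AE x in lebesgue_on \<Omega>. \<forall>i\<in>UNIV. g x $ i - g' x $ i = 0"
    by (intro AE_finite_allI) auto
  then show ?thesis by eventually_elim (simp add: vec_eq_iff)
qed

lemma weak_grad_AE_eq:
  assumes "open \<Omega>" "has_weak_grad \<Omega> u g"
  shows "AE x in lebesgue_on \<Omega>. weak_grad \<Omega> u x = g x"
proof -
  have "has_weak_grad \<Omega> u (weak_grad \<Omega> u)" unfolding weak_grad_def by (rule someI[of _ g]) (rule assms(2))
  then show ?thesis using weak_grad_unique[OF assms(1) _ assms(2)] by simp
qed

section \<open>Calculus in \<open>H\<^sub>0\<^sup>1(\<Omega>)\<close>\<close>

text \<open>\<open>u \<in> H\<^sub>0\<^sup>1(\<Omega>)\<close> with gradient \<open>g\<close>, described by approximation alone. In contrast to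
  \<open>u \<in> H10 \<Omega>\<close> this involves no chosen representative \<open>weak_grad \<Omega> u\<close>, and that \<open>g\<close> is a weak gradient is a
  consequence.\<close>

definition H10_grad :: "(real ^ 'n) set \<Rightarrow> (real ^ 'n \<Rightarrow> real) \<Rightarrow> (real ^ 'n \<Rightarrow> real ^ 'n) \<Rightarrow> bool" where
  "H10_grad \<Omega> u g \<longleftrightarrow> (\<exists>\<phi>. (\<forall>m. \<phi> m \<in> test_functions \<Omega>) \<and>
     L2_conv (lebesgue_on \<Omega>) \<phi> u \<and> L2_conv (lebesgue_on \<Omega>) (\<lambda>m. grad (\<phi> m)) g)"

lemma H10_grad_L2:
  assumes "H10_grad \<Omega> u g"
  shows "L2 (lebesgue_on \<Omega>) u" "L2 (lebesgue_on \<Omega>) g"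
  using assms by (auto simp: H10_grad_def L2_conv_def)

context
  fixes \<Omega> :: "(real ^ 'n) set"
  assumes \<Omega>_open: "open \<Omega>" and \<Omega>_bounded: "bounded \<Omega>"
begin

lemma open_in_sets_lebesgue: "\<Omega> \<in> sets lebesgue"
  using \<Omega>_open by auto

lemma finite_measure_bounded_open: "finite_measure (lebesgue_on \<Omega>)"
  by (intro finite_measure_lebesgue_on lmeasurable_open \<Omega>_open \<Omega>_bounded)

lemma integrable_L1_loc:
  fixes f :: "real ^ 'n \<Rightarrow> 'b::euclidean_space"
  assumes "integrable (lebesgue_on \<Omega>) f" shows "f \<in> L1_loc \<Omega>"
  unfolding L1_loc_def using set_integrable_of_lebesgue_on[OF assms open_in_sets_lebesgue]
  by (auto intro: lmeasurable_compact fmeasurableD)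

lemma bounded_measurable_L2:
  fixes f :: "real ^ 'n \<Rightarrow> 'b::euclidean_space"
  assumes "f \<in> borel_measurable (lebesgue_on \<Omega>)" "\<And>x. norm (f x) \<le> C"
  shows "L2 (lebesgue_on \<Omega>) f"
proof -
  interpret finite_measure "lebesgue_on \<Omega>" by (rule finite_measure_bounded_open)
  have "norm ((norm (f x))\<^sup>2) \<le> C\<^sup>2" for x using assms(2)[of x] by (simp add: power_mono)
  then have "integrable (lebesgue_on \<Omega>) (\<lambda>x. (norm (f x))\<^sup>2)"
    using assms(1) by (intro integrable_const_bound[where B = "C\<^sup>2"]) auto
  then show ?thesis using assms(1) by (simp add: L2_def)
qed

lemma test_function_L2:
  assumes "\<phi> \<in> test_functions \<Omega>"
  shows "L2 (lebesgue_on \<Omega>) \<phi>" "L2 (lebesgue_on \<Omega>) (grad \<phi>)"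
proof -
  obtain M where M: "\<And>x. \<bar>\<phi> x\<bar> \<le> M" "\<And>x. norm (grad \<phi> x) \<le> M"
    using test_functions_bounded[OF assms] by metis
  note s = test_functions_smooth[OF assms]
  show "L2 (lebesgue_on \<Omega>) \<phi>" "L2 (lebesgue_on \<Omega>) (grad \<phi>)"
    using M by (auto intro!: bounded_measurable_L2 continuous_measurable_lebesgue_on
        smooth_imp_continuous[OF s] continuous_grad[OF s])
qed

lemma test_function_H10_grad:
  assumes "\<phi> \<in> test_functions \<Omega>" shows "H10_grad \<Omega> \<phi> (grad \<phi>)"
  unfolding H10_grad_def using assms test_function_L2[OF assms]
  by (intro exI[of _ "\<lambda>_. \<phi>"]) (auto simp: L2_conv_def)

lemma test_integration_by_parts:
  assumes \<phi>: "\<phi> \<in> test_functions \<Omega>" and \<psi>: "\<psi> \<in> test_functions \<Omega>"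
  shows "(LINT x|lebesgue_on \<Omega>. \<phi> x * grad \<psi> x $ i) = - (LINT x|lebesgue_on \<Omega>. grad \<phi> x $ i * \<psi> x)"
proof -
  note s = test_functions_smooth[OF \<phi>] test_functions_smooth[OF \<psi>]
  have g: "grad (\<lambda>x. \<phi> x * \<psi> x) x $ i = \<phi> x * grad \<psi> x $ i + grad \<phi> x $ i * \<psi> x" for x
    by (simp add: grad_mult smooth_imp_differentiable s)
  have "(LINT x|lebesgue_on \<Omega>. \<phi> x * grad \<psi> x $ i + grad \<phi> x $ i * \<psi> x) = 0"
    using integral_lebesgue_on_grad_eq_0[OF open_in_sets_lebesgue test_functions_mult[OF \<psi> s(1)], of i] by (simp add: g)
  moreover have "integrable (lebesgue_on \<Omega>) (\<lambda>x. \<phi> x * grad \<psi> x $ i)"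
    "integrable (lebesgue_on \<Omega>) (\<lambda>x. grad \<phi> x $ i * \<psi> x)"
    by (intro L2_mult_integrable L2_component test_function_L2 \<phi> \<psi>)+
  ultimately show ?thesis by simp
qed

lemma H10_grad_has_weak_grad:
  assumes "H10_grad \<Omega> u g" shows "has_weak_grad \<Omega> u g"
proof -
  interpret finite_measure "lebesgue_on \<Omega>" by (rule finite_measure_bounded_open)
  obtain \<phi> where \<phi>: "\<And>m. \<phi> m \<in> test_functions \<Omega>" "L2_conv (lebesgue_on \<Omega>) \<phi> u"
      "L2_conv (lebesgue_on \<Omega>) (\<lambda>m. grad (\<phi> m)) g"
    using assms unfolding H10_grad_def by auto
  have "(LINT x|lebesgue_on \<Omega>. u x * grad \<psi> x $ i) = - (LINT x|lebesgue_on \<Omega>. g x $ i * \<psi> x)"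
    if \<psi>: "\<psi> \<in> test_functions \<Omega>" for \<psi> i
  proof -
    have "(\<lambda>m. LINT x|lebesgue_on \<Omega>. grad \<psi> x $ i \<bullet> \<phi> m x) \<longlonglongrightarrow> (LINT x|lebesgue_on \<Omega>. grad \<psi> x $ i \<bullet> u x)"
      by (rule L2_conv_inner[OF L2_component[OF test_function_L2(2)[OF \<psi>]] \<phi>(2)])
    moreover have "(\<lambda>m. LINT x|lebesgue_on \<Omega>. (\<psi> x *\<^sub>R axis i 1) \<bullet> grad (\<phi> m) x) \<longlonglongrightarrow>
        (LINT x|lebesgue_on \<Omega>. (\<psi> x *\<^sub>R axis i 1) \<bullet> g x)"
      by (rule L2_conv_inner[OF _ \<phi>(3)])
        (rule L2_bound[OF test_function_L2(1)[OF \<psi>], where C = 1], auto simp: norm_axis_1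
          intro!: borel_measurable_scaleR L2_measurable[OF test_function_L2(1)[OF \<psi>]])
    then have "(\<lambda>m. - (LINT x|lebesgue_on \<Omega>. grad (\<phi> m) x $ i * \<psi> x)) \<longlonglongrightarrow> - (LINT x|lebesgue_on \<Omega>. g x $ i * \<psi> x)"
      by (intro tendsto_minus) (simp add: inner_axis' mult.commute)
    moreover have "(LINT x|lebesgue_on \<Omega>. grad \<psi> x $ i \<bullet> \<phi> m x) = - (LINT x|lebesgue_on \<Omega>. grad (\<phi> m) x $ i * \<psi> x)" for m
      using test_integration_by_parts[OF \<phi>(1) \<psi>, of m i] by (simp add: mult.commute)
    ultimately show ?thesis using LIMSEQ_unique by (fastforce simp: mult.commute)
  qed
  then show ?thesis
    using H10_grad_L2[OF assms] by (auto simp: has_weak_grad_def intro!: integrable_L1_loc L2_integrable)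
qed

lemma H10_grad_imp_H10:
  assumes "H10_grad \<Omega> u g"
  shows "u \<in> H10 \<Omega>" and "AE x in lebesgue_on \<Omega>. weak_grad \<Omega> u x = g x"
proof -
  note w = H10_grad_has_weak_grad[OF assms] and L = H10_grad_L2[OF assms]
  show ae: "AE x in lebesgue_on \<Omega>. weak_grad \<Omega> u x = g x"
    by (rule weak_grad_AE_eq[OF \<Omega>_open w])
  have Lw: "L2 (lebesgue_on \<Omega>) (weak_grad \<Omega> u)"
    by (rule L2_cong_AE[OF open_in_sets_lebesgue L(2)]) (use ae in eventually_elim, simp)
  obtain \<phi> where \<phi>: "\<And>m. \<phi> m \<in> test_functions \<Omega>" "L2_conv (lebesgue_on \<Omega>) \<phi> u"
      "L2_conv (lebesgue_on \<Omega>) (\<lambda>m. grad (\<phi> m)) g"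
    using assms unfolding H10_grad_def by auto
  have "(LINT x|lebesgue_on \<Omega>. (norm (grad (\<phi> m) x - weak_grad \<Omega> u x))\<^sup>2)
      = (LINT x|lebesgue_on \<Omega>. (norm (grad (\<phi> m) x - g x))\<^sup>2)" for m
    by (rule integral_cong_AE)
      (use ae in \<open>auto intro!: borel_measurable_integrable L2_norm_sq L2_diff test_function_L2 \<phi> L Lw\<close>)
  then have "(\<lambda>m. (LINT x|lebesgue_on \<Omega>. (\<phi> m x - u x)\<^sup>2)
        + (LINT x|lebesgue_on \<Omega>. (norm (grad (\<phi> m) x - weak_grad \<Omega> u x))\<^sup>2)) \<longlonglongrightarrow> 0 + 0"
    using \<phi> by (intro tendsto_add) (auto simp: L2_conv_def)
  then have "(\<lambda>m. (LINT x|lebesgue_on \<Omega>. (\<phi> m x - u x)\<^sup>2)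
        + (LINT x|lebesgue_on \<Omega>. (norm (grad (\<phi> m) x - weak_grad \<Omega> u x))\<^sup>2)) \<longlonglongrightarrow> 0" by simp
  moreover have "u \<in> H1 \<Omega>" unfolding H1_def using L w by (auto simp: L_space_2_iff)
  ultimately show "u \<in> H10 \<Omega>" unfolding H10_def using \<phi>(1) by blast
qed

lemma H10_imp_H10_grad:
  assumes "u \<in> H10 \<Omega>" shows "H10_grad \<Omega> u (weak_grad \<Omega> u)"
proof -
  obtain g where u: "L2 (lebesgue_on \<Omega>) u" and g: "L2 (lebesgue_on \<Omega>) g" "has_weak_grad \<Omega> u g"
    using assms by (auto simp: H10_def H1_def L_space_2_iff)
  have ae: "AE x in lebesgue_on \<Omega>. weak_grad \<Omega> u x = g x"
    by (rule weak_grad_AE_eq[OF \<Omega>_open g(2)])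
  have Lw: "L2 (lebesgue_on \<Omega>) (weak_grad \<Omega> u)"
    by (rule L2_cong_AE[OF open_in_sets_lebesgue g(1)]) (use ae in eventually_elim, simp)
  obtain \<phi> where \<phi>: "\<And>m. \<phi> m \<in> test_functions \<Omega>"
    and lim: "(\<lambda>m. (LINT x|lebesgue_on \<Omega>. (\<phi> m x - u x)\<^sup>2)
        + (LINT x|lebesgue_on \<Omega>. (norm (grad (\<phi> m) x - weak_grad \<Omega> u x))\<^sup>2)) \<longlonglongrightarrow> 0"
    using assms unfolding H10_def by auto
  have "(\<lambda>m. LINT x|lebesgue_on \<Omega>. (\<phi> m x - u x)\<^sup>2) \<longlonglongrightarrow> 0"
    by (rule Lim_null_comparison[OF _ lim]) auto
  moreover have "(\<lambda>m. LINT x|lebesgue_on \<Omega>. (norm (grad (\<phi> m) x - weak_grad \<Omega> u x))\<^sup>2) \<longlonglongrightarrow> 0"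
    by (rule Lim_null_comparison[OF _ lim]) auto
  ultimately show ?thesis unfolding H10_grad_def L2_conv_def
    using u Lw \<phi> test_function_L2 by (intro exI[of _ \<phi>]) auto
qed

lemma H10_grad_add:
  assumes "H10_grad \<Omega> u g" "H10_grad \<Omega> v h"
  shows "H10_grad \<Omega> (\<lambda>x. u x + v x) (\<lambda>x. g x + h x)"
proof -
  obtain \<phi> where \<phi>: "\<And>m. \<phi> m \<in> test_functions \<Omega>" "L2_conv (lebesgue_on \<Omega>) \<phi> u"
      "L2_conv (lebesgue_on \<Omega>) (\<lambda>m. grad (\<phi> m)) g"
    using assms(1) unfolding H10_grad_def by auto
  obtain \<psi> where \<psi>: "\<And>m. \<psi> m \<in> test_functions \<Omega>" "L2_conv (lebesgue_on \<Omega>) \<psi> v"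
      "L2_conv (lebesgue_on \<Omega>) (\<lambda>m. grad (\<psi> m)) h"
    using assms(2) unfolding H10_grad_def by auto
  have "grad (\<lambda>x. \<phi> m x + \<psi> m x) = (\<lambda>x. grad (\<phi> m) x + grad (\<psi> m) x)" for m
    using test_functions_smooth[OF \<phi>(1)] test_functions_smooth[OF \<psi>(1)]
    by (auto simp: grad_add smooth_imp_differentiable)
  then show ?thesis unfolding H10_grad_def
    using \<phi> \<psi> L2_conv_add[OF \<phi>(2) \<psi>(2)] L2_conv_add[OF \<phi>(3) \<psi>(3)]
    by (intro exI[of _ "\<lambda>m x. \<phi> m x + \<psi> m x"]) (auto simp: test_functions_add)
qed

lemma H10_grad_scaleR:
  assumes "H10_grad \<Omega> u g"
  shows "H10_grad \<Omega> (\<lambda>x. c * u x) (\<lambda>x. c *\<^sub>R g x)"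
proof -
  obtain \<phi> where \<phi>: "\<And>m. \<phi> m \<in> test_functions \<Omega>" "L2_conv (lebesgue_on \<Omega>) \<phi> u"
      "L2_conv (lebesgue_on \<Omega>) (\<lambda>m. grad (\<phi> m)) g"
    using assms(1) unfolding H10_grad_def by auto
  have c: "smooth (\<lambda>_. c)" by (simp add: smooth_def C_k_const)
  have "grad (\<lambda>x. c * \<phi> m x) = (\<lambda>x. c *\<^sub>R grad (\<phi> m) x)" for m
    using test_functions_smooth[OF \<phi>(1)] c by (auto simp: grad_mult grad_const smooth_imp_differentiable)
  then show ?thesis unfolding H10_grad_def
    using \<phi>(1) L2_conv_scaleR[OF \<phi>(2), of c] L2_conv_scaleR[OF \<phi>(3), of c] test_functions_mult[OF \<phi>(1) c]
    by (intro exI[of _ "\<lambda>m x. c * \<phi> m x"]) auto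
qed

lemma H10_grad_diff:
  assumes "H10_grad \<Omega> u g" "H10_grad \<Omega> v h"
  shows "H10_grad \<Omega> (\<lambda>x. u x - v x) (\<lambda>x. g x - h x)"
  using H10_grad_add[OF assms(1) H10_grad_scaleR[OF assms(2), of "-1"]] by simp

text \<open>The composed approximations \<open>S \<circ> \<phi>\<^sub>m\<close> are test functions. Their values converge because \<open>S\<close> is
  Lipschitz; for the gradients, one passes to a subsequence converging almost everywhere and splits
  \<open>S'(\<phi>\<^sub>m) D\<phi>\<^sub>m - S'(u) g = S'(\<phi>\<^sub>m) (D\<phi>\<^sub>m - g) + (S'(\<phi>\<^sub>m) - S'(u)) g\<close>, the last term being controlled by dominated
  convergence.\<close>

lemma H10_grad_compose:
  assumes u: "H10_grad \<Omega> u g" and S: "smooth_real S" "S 0 = 0"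
    and S': "\<And>s. (S has_real_derivative S' s) (at s)" "continuous_on UNIV S'" "\<And>s. \<bar>S' s\<bar> \<le> C"
  shows "H10_grad \<Omega> (\<lambda>x. S (u x)) (\<lambda>x. S' (u x) *\<^sub>R g x)"
proof -
  let ?M = "lebesgue_on \<Omega>"
  have C0: "C \<ge> 0" using S'(3)[of 0] by simp
  obtain \<phi>0 where \<phi>0: "\<And>m. \<phi>0 m \<in> test_functions \<Omega>" "L2_conv ?M \<phi>0 u"
      "L2_conv ?M (\<lambda>m. grad (\<phi>0 m)) g"
    using u unfolding H10_grad_def by auto
  obtain r where r: "strict_mono r" "AE x in ?M. (\<lambda>n. \<phi>0 (r n) x) \<longlonglongrightarrow> u x"
    using L2_conv_AE_subseq[OF \<phi>0(2)] by blast
  define \<phi> where "\<phi> n = \<phi>0 (r n)" for n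
  have \<phi>: "\<And>m. \<phi> m \<in> test_functions \<Omega>" "L2_conv ?M \<phi> u" "L2_conv ?M (\<lambda>m. grad (\<phi> m)) g"
    and ae: "AE x in ?M. (\<lambda>n. \<phi> n x) \<longlonglongrightarrow> u x"
    using \<phi>0 r L2_conv_subseq[OF \<phi>0(2) r(1)] L2_conv_subseq[OF \<phi>0(3) r(1)] unfolding \<phi>_def[abs_def] by blast+
  note Lu = H10_grad_L2[OF u] and L\<phi> = test_function_L2[OF \<phi>(1)]
  have contS: "continuous_on UNIV S" by (meson S'(1) DERIV_continuous_on has_field_derivative_at_within)
  have mS: "S \<in> borel_measurable borel" "S' \<in> borel_measurable borel"
    by (intro borel_measurable_continuous_onI contS S'(2))+
  have lip: "\<bar>S a - S b\<bar> \<le> C * \<bar>a - b\<bar>" for a b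
    using field_differentiable_bound[of UNIV S S' C a b] S' by auto
  have Sm: "(\<lambda>x. S (\<phi> m x)) \<in> test_functions \<Omega>" for m by (rule test_functions_compose[OF \<phi>(1) S])
  have gS: "grad (\<lambda>x. S (\<phi> m x)) = (\<lambda>x. S' (\<phi> m x) *\<^sub>R grad (\<phi> m) x)" for m
    using grad_compose[OF smooth_imp_differentiable[OF test_functions_smooth[OF \<phi>(1)]] S'(1)] by auto
  have LSu: "L2 ?M (\<lambda>x. S (u x))"
    by (rule L2_bound[OF Lu(1) measurable_compose[OF L2_measurable[OF Lu(1)] mS(1)], where C = C])
      (use lip[of _ 0] S(2) in auto)
  have mSu: "(\<lambda>x. S' (u x)) \<in> borel_measurable ?M" by (rule measurable_compose[OF L2_measurable[OF Lu(1)] mS(2)])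
  have mS\<phi>: "(\<lambda>x. S' (\<phi> m x)) \<in> borel_measurable ?M" for m
    by (rule measurable_compose[OF L2_measurable[OF L\<phi>(1)] mS(2)])
  have LSg: "L2 ?M (\<lambda>x. S' (u x) *\<^sub>R g x)"
    by (rule L2_bounded_scaleR[OF Lu(2) mSu, where C = C]) (use S'(3) in auto)
  have "L2_conv ?M (\<lambda>m x. S (\<phi> m x)) (\<lambda>x. S (u x))"
  proof (rule L2_conv_squeeze[OF test_function_L2(1)[OF Sm] LSu])
    have i: "integrable ?M (\<lambda>x. (norm (\<phi> n x - u x))\<^sup>2)" for n by (intro L2_norm_sq L2_diff L\<phi> Lu)
    then show "integrable ?M (\<lambda>x. C\<^sup>2 * (norm (\<phi> n x - u x))\<^sup>2)" for n by (rule integrable_mult_right)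
    show "(\<lambda>n. LINT x|?M. C\<^sup>2 * (norm (\<phi> n x - u x))\<^sup>2) \<longlonglongrightarrow> 0"
      using \<phi>(2) by (auto simp: L2_conv_def intro!: tendsto_mult_right_zero)
    show "AE x in ?M. (norm (S (\<phi> n x) - S (u x)))\<^sup>2 \<le> C\<^sup>2 * (norm (\<phi> n x - u x))\<^sup>2" for n
      by (rule always_eventually, rule allI, subst power_mult_distrib[symmetric], rule power_mono)
        (use lip in auto)
  qed
  moreover have "L2_conv ?M (\<lambda>m x. S' (\<phi> m x) *\<^sub>R grad (\<phi> m) x) (\<lambda>x. S' (u x) *\<^sub>R g x)"
  proof (rule L2_conv_squeeze)
    let ?a = "\<lambda>n x. (norm (grad (\<phi> n) x - g x))\<^sup>2"
    let ?b = "\<lambda>n x. (S' (\<phi> n x) - S' (u x))\<^sup>2 * (norm (g x))\<^sup>2"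
    show "L2 ?M (\<lambda>x. S' (\<phi> n x) *\<^sub>R grad (\<phi> n) x)" for n
      using test_function_L2(2)[OF Sm] by (simp add: gS)
    have ia: "integrable ?M (?a n)" for n by (intro L2_norm_sq L2_diff L\<phi> Lu)
    have dom: "norm (?b n x) \<le> (2 * C)\<^sup>2 * (norm (g x))\<^sup>2" for n x
    proof -
      have "\<bar>S' (\<phi> n x) - S' (u x)\<bar> \<le> 2 * C" using S'(3)[of "\<phi> n x"] S'(3)[of "u x"] by linarith
      then have "(S' (\<phi> n x) - S' (u x))\<^sup>2 \<le> (2 * C)\<^sup>2"
        using C0 by (subst abs_le_square_iff[symmetric]) simp
      then show ?thesis by (simp add: mult_right_mono)
    qed
    have ig: "integrable ?M (\<lambda>x. (2 * C)\<^sup>2 * (norm (g x))\<^sup>2)" by (intro integrable_mult_right L2_norm_sq Lu)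
    have mb: "?b n \<in> borel_measurable ?M" for n
      using mS\<phi>[of n] mSu L2_measurable[OF Lu(2)] by measurable
    have ib: "integrable ?M (?b n)" for n
      by (rule Bochner_Integration.integrable_bound[OF ig mb]) (use dom[of n] in \<open>auto intro: order_trans\<close>)
    have "(\<lambda>n. LINT x|?M. ?b n x) \<longlonglongrightarrow> (LINT x|?M. 0)"
    proof (rule integral_dominated_convergence[OF _ mb ig])
      show "AE x in ?M. (\<lambda>n. ?b n x) \<longlonglongrightarrow> 0" using ae
      proof eventually_elim
        case (elim x)
        have "isCont S' (u x)" using S'(2) by (simp add: continuous_on_eq_continuous_at)
        then have "(\<lambda>n. S' (\<phi> n x)) \<longlonglongrightarrow> S' (u x)" using elim by (rule isCont_tendsto_compose)
        then have "(\<lambda>n. ?b n x) \<longlonglongrightarrow> (S' (u x) - S' (u x))\<^sup>2 * (norm (g x))\<^sup>2" by (intro tendsto_intros)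
        then show ?case by simp
      qed
    qed (use dom in auto)
    then have "(\<lambda>n. 2 * C\<^sup>2 * (LINT x|?M. ?a n x) + 2 * (LINT x|?M. ?b n x)) \<longlonglongrightarrow> 2 * C\<^sup>2 * 0 + 2 * 0"
      using \<phi>(3) by (intro tendsto_intros) (auto simp: L2_conv_def)
    then show "(\<lambda>n. LINT x|?M. 2 * C\<^sup>2 * ?a n x + 2 * ?b n x) \<longlonglongrightarrow> 0" using ia ib by simp
    show "integrable ?M (\<lambda>x. 2 * C\<^sup>2 * ?a n x + 2 * ?b n x)" for n using ia ib by simp
    have pt: "(norm (s *\<^sub>R G - t *\<^sub>R H))\<^sup>2 \<le> 2 * C\<^sup>2 * (norm (G - H))\<^sup>2 + 2 * ((s - t)\<^sup>2 * (norm H)\<^sup>2)"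
      if "\<bar>s\<bar> \<le> C" for s t and G H :: "real ^ 'n"
    proof -
      have "s *\<^sub>R G - t *\<^sub>R H = s *\<^sub>R (G - H) + (s - t) *\<^sub>R H" by (simp add: algebra_simps)
      then have "(norm (s *\<^sub>R G - t *\<^sub>R H))\<^sup>2 \<le> 2 * (s\<^sup>2 * (norm (G - H))\<^sup>2) + 2 * ((s - t)\<^sup>2 * (norm H)\<^sup>2)"
        using norm_add_sq_le[of "s *\<^sub>R (G - H)" "(s - t) *\<^sub>R H"] by (simp add: power_mult_distrib)
      moreover have "s\<^sup>2 \<le> C\<^sup>2" using that C0 by (simp add: abs_le_square_iff[symmetric])
      then have "s\<^sup>2 * (norm (G - H))\<^sup>2 \<le> C\<^sup>2 * (norm (G - H))\<^sup>2" by (rule mult_right_mono) simp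
      ultimately show ?thesis by simp
    qed
    show "AE x in ?M. (norm (S' (\<phi> n x) *\<^sub>R grad (\<phi> n) x - S' (u x) *\<^sub>R g x))\<^sup>2 \<le> 2 * C\<^sup>2 * ?a n x + 2 * ?b n x" for n
      using pt[OF S'(3)] by auto
  qed (rule LSg)
  ultimately show ?thesis unfolding H10_grad_def using Sm gS
    by (intro exI[of _ "\<lambda>m x. S (\<phi> m x)"]) auto
qed

text \<open>For a test function in place of \<open>f\<close>, the formula is the definition of the weak gradient of \<open>g\<close> applied to the test
  function \<open>f \<psi>\<close>; all terms are continuous in \<open>f\<close> with respect to convergence of values and gradients.\<close>

lemma has_weak_grad_mult:
  assumes f: "H10_grad \<Omega> f Df" and g: "L2 (lebesgue_on \<Omega>) g" "L2 (lebesgue_on \<Omega>) Dg" "has_weak_grad \<Omega> g Dg"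
  shows "has_weak_grad \<Omega> (\<lambda>x. f x * g x) (\<lambda>x. f x *\<^sub>R Dg x + g x *\<^sub>R Df x)"
proof -
  let ?M = "lebesgue_on \<Omega>"
  obtain \<phi> where \<phi>: "\<And>m. \<phi> m \<in> test_functions \<Omega>" "L2_conv ?M \<phi> f" "L2_conv ?M (\<lambda>m. grad (\<phi> m)) Df"
    using f unfolding H10_grad_def by auto
  note Lf = H10_grad_L2[OF f]
  have "(LINT x|?M. (f x * g x) * grad \<psi> x $ i) = - (LINT x|?M. (f x *\<^sub>R Dg x + g x *\<^sub>R Df x) $ i * \<psi> x)"
    if \<psi>: "\<psi> \<in> test_functions \<Omega>" for \<psi> i
  proof -
    obtain B where B: "\<And>x. \<bar>\<psi> x\<bar> \<le> B" "\<And>x. norm (grad \<psi> x) \<le> B" using test_functions_bounded[OF \<psi>] by metis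
    have B': "\<bar>grad \<psi> x $ i\<bar> \<le> B" for x using B(2)[of x] component_le_norm_cart[of "grad \<psi> x" i] by simp
    note L\<psi> = test_function_L2[OF \<psi>]
    have h1: "L2 ?M (\<lambda>x. grad \<psi> x $ i *\<^sub>R g x)"
      by (rule L2_bounded_scaleR[OF g(1) L2_measurable[OF L2_component[OF L\<psi>(2)]], where C = B]) (use B' in auto)
    have h2: "L2 ?M (\<lambda>x. \<psi> x *\<^sub>R Dg x $ i)"
      by (rule L2_bounded_scaleR[OF L2_component[OF g(2)] L2_measurable[OF L\<psi>(1)], where C = B]) (use B in auto)
    have h3': "L2 ?M (\<lambda>x. \<psi> x *\<^sub>R g x)"
      by (rule L2_bounded_scaleR[OF g(1) L2_measurable[OF L\<psi>(1)], where C = B]) (use B in auto)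
    have h3: "L2 ?M (\<lambda>x. (\<psi> x * g x) *\<^sub>R axis i 1 :: real ^ 'n)"
      by (rule L2_bound[OF h3', where C = 1])
        (use L2_measurable[OF h3'] in \<open>auto simp: norm_axis_1 intro!: borel_measurable_scaleR\<close>)
    have eq: "(LINT x|?M. (grad \<psi> x $ i *\<^sub>R g x) \<bullet> \<phi> m x) + (LINT x|?M. ((\<psi> x * g x) *\<^sub>R axis i 1) \<bullet> grad (\<phi> m) x)
        = - (LINT x|?M. (\<psi> x *\<^sub>R Dg x $ i) \<bullet> \<phi> m x)" for m
    proof -
      note s = test_functions_smooth[OF \<phi>(1)[of m]] test_functions_smooth[OF \<psi>]
      have gr: "grad (\<lambda>x. \<phi> m x * \<psi> x) x $ i = \<phi> m x * grad \<psi> x $ i + \<psi> x * grad (\<phi> m) x $ i" for x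
        by (simp add: grad_mult smooth_imp_differentiable s)
      have "(LINT x|?M. g x * grad (\<lambda>x. \<phi> m x * \<psi> x) x $ i) = - (LINT x|?M. Dg x $ i * (\<phi> m x * \<psi> x))"
        using g(3) test_functions_mult[OF \<psi> s(1)] unfolding has_weak_grad_def by blast
      moreover have "(LINT x|?M. g x * grad (\<lambda>x. \<phi> m x * \<psi> x) x $ i)
          = (LINT x|?M. (grad \<psi> x $ i *\<^sub>R g x) \<bullet> \<phi> m x + ((\<psi> x * g x) *\<^sub>R axis i 1) \<bullet> grad (\<phi> m) x)"
        by (rule Bochner_Integration.integral_cong) (simp_all add: gr inner_axis', simp_all add: algebra_simps)
      moreover have "(LINT x|?M. Dg x $ i * (\<phi> m x * \<psi> x)) = (LINT x|?M. (\<psi> x *\<^sub>R Dg x $ i) \<bullet> \<phi> m x)"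
        by (rule Bochner_Integration.integral_cong) (auto simp: algebra_simps)
      moreover have "integrable ?M (\<lambda>x. (grad \<psi> x $ i *\<^sub>R g x) \<bullet> \<phi> m x)"
         "integrable ?M (\<lambda>x. ((\<psi> x * g x) *\<^sub>R axis i 1) \<bullet> grad (\<phi> m) x)"
        by (intro L2_inner_integrable h1 h3 test_function_L2 \<phi>(1))+
      ultimately show ?thesis by simp
    qed
    have "(\<lambda>m. (LINT x|?M. (grad \<psi> x $ i *\<^sub>R g x) \<bullet> \<phi> m x) + (LINT x|?M. ((\<psi> x * g x) *\<^sub>R axis i 1) \<bullet> grad (\<phi> m) x))
      \<longlonglongrightarrow> (LINT x|?M. (grad \<psi> x $ i *\<^sub>R g x) \<bullet> f x) + (LINT x|?M. ((\<psi> x * g x) *\<^sub>R axis i 1) \<bullet> Df x)"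
      by (intro tendsto_add L2_conv_inner h1 h3 \<phi>)
    moreover have "(\<lambda>m. - (LINT x|?M. (\<psi> x *\<^sub>R Dg x $ i) \<bullet> \<phi> m x)) \<longlonglongrightarrow> - (LINT x|?M. (\<psi> x *\<^sub>R Dg x $ i) \<bullet> f x)"
      by (intro tendsto_minus L2_conv_inner h2 \<phi>)
    ultimately have lim: "(LINT x|?M. (grad \<psi> x $ i *\<^sub>R g x) \<bullet> f x) + (LINT x|?M. ((\<psi> x * g x) *\<^sub>R axis i 1) \<bullet> Df x)
       = - (LINT x|?M. (\<psi> x *\<^sub>R Dg x $ i) \<bullet> f x)"
      unfolding eq by (rule LIMSEQ_unique)
    have int: "integrable ?M (\<lambda>x. ((\<psi> x * g x) *\<^sub>R axis i 1) \<bullet> Df x)" "integrable ?M (\<lambda>x. (\<psi> x *\<^sub>R Dg x $ i) \<bullet> f x)"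
      by (intro L2_inner_integrable h2 h3 Lf)+
    have "(LINT x|?M. (f x * g x) * grad \<psi> x $ i) = (LINT x|?M. (grad \<psi> x $ i *\<^sub>R g x) \<bullet> f x)"
      by (rule Bochner_Integration.integral_cong) (auto simp: algebra_simps)
    also have "\<dots> = - ((LINT x|?M. ((\<psi> x * g x) *\<^sub>R axis i 1) \<bullet> Df x) + (LINT x|?M. (\<psi> x *\<^sub>R Dg x $ i) \<bullet> f x))"
      using lim by linarith
    also have "\<dots> = - (LINT x|?M. ((\<psi> x * g x) *\<^sub>R axis i 1) \<bullet> Df x + (\<psi> x *\<^sub>R Dg x $ i) \<bullet> f x)"
      using int by simp
    also have "\<dots> = - (LINT x|?M. (f x *\<^sub>R Dg x + g x *\<^sub>R Df x) $ i * \<psi> x)"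
      by (intro arg_cong[where f = uminus] Bochner_Integration.integral_cong)
        (auto simp: inner_axis' algebra_simps)
    finally show ?thesis .
  qed
  moreover have "integrable ?M (\<lambda>x. f x * g x)" by (rule L2_mult_integrable[OF Lf(1) g(1)])
  moreover have "integrable ?M (\<lambda>x. f x *\<^sub>R Dg x + g x *\<^sub>R Df x)"
    by (intro Bochner_Integration.integrable_add L2_scaleR_integrable Lf g)
  ultimately show ?thesis by (auto simp: has_weak_grad_def intro!: integrable_L1_loc)
qed

text \<open>A form of Poincare's argument. If \<open>\<phi>\<^sub>m\<close> approximates \<open>z\<close>, testing the vanishing weak gradient with
  \<open>x\<^sub>i \<phi>\<^sub>m\<close> gives \<open>\<integral>z \<phi>\<^sub>m + \<integral>z x\<^sub>i \<partial>\<^sub>i\<phi>\<^sub>m = 0\<close>. As \<open>x\<^sub>i\<close> is bounded on \<open>\<Omega>\<close>, the second integral tends to zero,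
  and the first one to \<open>\<integral>z\<^sup>2\<close>.\<close>

lemma H10_zero_grad:
  assumes z: "H10_grad \<Omega> z g" and 0: "AE x in lebesgue_on \<Omega>. g x = 0"
  shows "AE x in lebesgue_on \<Omega>. z x = 0"
proof -
  let ?M = "lebesgue_on \<Omega>"
  obtain \<phi> where \<phi>: "\<And>m. \<phi> m \<in> test_functions \<Omega>" "L2_conv ?M \<phi> z" "L2_conv ?M (\<lambda>m. grad (\<phi> m)) g"
    using z unfolding H10_grad_def by auto
  note L = H10_grad_L2[OF z] and w = H10_grad_has_weak_grad[OF z]
  \<comment> \<open>Any coordinate will do; index types are nonempty.\<close>
  fix i :: 'n
  obtain B where B: "\<And>x. x \<in> \<Omega> \<Longrightarrow> norm x \<le> B" using \<Omega>_bounded unfolding bounded_iff by auto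
  have h': "L2 ?M (\<lambda>x. x $ i *\<^sub>R z x)"
  proof (rule L2_bounded_scaleR[OF L(1), where C = B])
    show "(\<lambda>x. x $ i) \<in> borel_measurable ?M"
      by (intro continuous_measurable_lebesgue_on continuous_intros)
    show "AE x in ?M. \<bar>x $ i\<bar> \<le> B"
      by (rule AE_I2) (use B component_le_norm_cart order_trans in \<open>fastforce\<close>)
  qed
  have h: "L2 ?M (\<lambda>x. (x $ i * z x) *\<^sub>R axis i 1 :: real ^ 'n)"
    by (rule L2_bound[OF h', where C = 1])
      (use L2_measurable[OF h'] in \<open>auto simp: norm_axis_1 intro!: borel_measurable_scaleR\<close>)
  have eq: "(LINT x|?M. ((x $ i * z x) *\<^sub>R axis i 1) \<bullet> grad (\<phi> m) x) + (LINT x|?M. z x \<bullet> \<phi> m x) = 0" for m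
  proof -
    have sc: "smooth (\<lambda>x :: real ^ 'n. x $ i)" by (simp add: smooth_def C_k_component)
    note s = test_functions_smooth[OF \<phi>(1)[of m]]
    have gr: "grad (\<lambda>x. x $ i * \<phi> m x) x $ i = x $ i * grad (\<phi> m) x $ i + \<phi> m x" for x
      by (simp add: grad_mult grad_component smooth_imp_differentiable s sc)
    have "(LINT x|?M. z x * grad (\<lambda>x. x $ i * \<phi> m x) x $ i) = - (LINT x|?M. g x $ i * (x $ i * \<phi> m x))"
      using w test_functions_mult[OF \<phi>(1) sc] unfolding has_weak_grad_def by blast
    moreover have "(LINT x|?M. g x $ i * (x $ i * \<phi> m x)) = 0"
      by (rule integral_eq_zero_AE) (use 0 in eventually_elim, simp)
    moreover have "(LINT x|?M. z x * grad (\<lambda>x. x $ i * \<phi> m x) x $ i)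
       = (LINT x|?M. ((x $ i * z x) *\<^sub>R axis i 1) \<bullet> grad (\<phi> m) x + z x \<bullet> \<phi> m x)"
      by (rule Bochner_Integration.integral_cong) (auto simp: gr inner_axis' algebra_simps)
    moreover have "integrable ?M (\<lambda>x. ((x $ i * z x) *\<^sub>R axis i 1) \<bullet> grad (\<phi> m) x)" "integrable ?M (\<lambda>x. z x \<bullet> \<phi> m x)"
      by (intro L2_inner_integrable h L test_function_L2 \<phi>(1))+
    ultimately show ?thesis by simp
  qed
  have "(\<lambda>m. (LINT x|?M. ((x $ i * z x) *\<^sub>R axis i 1) \<bullet> grad (\<phi> m) x) + (LINT x|?M. z x \<bullet> \<phi> m x)) \<longlonglongrightarrow>
     (LINT x|?M. ((x $ i * z x) *\<^sub>R axis i 1) \<bullet> g x) + (LINT x|?M. z x \<bullet> z x)"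
    by (intro tendsto_add L2_conv_inner h L \<phi>)
  then have "(LINT x|?M. ((x $ i * z x) *\<^sub>R axis i 1) \<bullet> g x) + (LINT x|?M. z x \<bullet> z x) = 0"
    unfolding eq by (simp add: LIMSEQ_const_iff)
  moreover have "(LINT x|?M. ((x $ i * z x) *\<^sub>R axis i 1) \<bullet> g x) = 0"
    by (rule integral_eq_zero_AE) (use 0 in eventually_elim, simp)
  ultimately have "(LINT x|?M. z x \<bullet> z x) = 0" by simp
  then have "AE x in ?M. z x \<bullet> z x = 0"
    using integral_nonneg_eq_0_iff_AE[OF L2_inner_integrable[OF L(1) L(1)]] by simp
  then show ?thesis by eventually_elim simp
qed

end

section \<open>The equation tested with a square\<close>

lemma transpose_matrix_vector_sum:
  fixes A :: "real ^ 'n ^ 'n"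
  shows "transpose A *v y = (\<Sum>i\<in>UNIV. \<Sum>j\<in>UNIV. A $ j $ i *\<^sub>R (y $ j *\<^sub>R axis i 1))"
proof -
  have "(\<Sum>i\<in>UNIV. \<Sum>j\<in>UNIV. A $ j $ i *\<^sub>R (y $ j *\<^sub>R axis i 1)) $ l = (\<Sum>j\<in>UNIV. A $ j $ l * y $ j)" for l
  proof -
    have "(\<Sum>i\<in>UNIV. \<Sum>j\<in>UNIV. A $ j $ i *\<^sub>R (y $ j *\<^sub>R axis i 1)) $ l
      = (\<Sum>i\<in>UNIV. (\<Sum>j\<in>UNIV. A $ j $ i * y $ j) * axis i 1 $ l)"
      by (simp add: sum_distrib_right mult.assoc)
    also have "\<dots> = (\<Sum>i\<in>UNIV. if i = l then (\<Sum>j\<in>UNIV. A $ j $ i * y $ j) else 0)"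
      by (rule sum.cong) (auto simp: axis_def)
    finally show ?thesis by simp
  qed
  then show ?thesis by (simp add: vec_eq_iff matrix_vector_mult_def transpose_def)
qed

lemma L2_transpose_matrix_vector_mult:
  fixes A :: "real ^ 'n \<Rightarrow> real ^ 'n ^ 'n"
  assumes "\<And>i j. (\<lambda>x. A x $ i $ j) \<in> Linf_space \<Omega>" and g: "L2 (lebesgue_on \<Omega>) g"
  shows "L2 (lebesgue_on \<Omega>) (\<lambda>x. transpose (A x) *v g x)"
  unfolding transpose_matrix_vector_sum
proof (intro L2_sum)
  fix i j :: 'n
  obtain C where C: "AE x in lebesgue_on \<Omega>. \<bar>A x $ j $ i\<bar> \<le> C" and m: "(\<lambda>x. A x $ j $ i) \<in> borel_measurable (lebesgue_on \<Omega>)"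
    using assms(1)[of j i] by (auto simp: Linf_space_def)
  have l: "L2 (lebesgue_on \<Omega>) (\<lambda>x. g x $ j *\<^sub>R (axis i 1 :: real ^ 'n))"
    by (rule L2_bound[OF L2_component[OF g, of j], where C = 1])
      (use L2_measurable[OF L2_component[OF g, of j]] in \<open>auto simp: norm_axis_1 intro!: borel_measurable_scaleR\<close>)
  show "L2 (lebesgue_on \<Omega>) (\<lambda>x. A x $ j $ i *\<^sub>R (g x $ j *\<^sub>R (axis i 1 :: real ^ 'n)))"
    by (rule L2_bounded_scaleR[OF l m C])
qed auto

lemma transpose_matrix_inner:
  fixes A :: "real ^ 'n ^ 'n"
  shows "(transpose A *v x) \<bullet> y = x \<bullet> (A *v y)"
  by (simp add: transpose_matrix_vector dot_lmul_matrix)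

lemma T_bound: "k > 0 \<Longrightarrow> \<bar>T k s\<bar> \<le> k"
  by (auto simp: T_def)

lemma T_measurable: "f \<in> borel_measurable M \<Longrightarrow> (\<lambda>x. T k (f x)) \<in> borel_measurable M"
  unfolding T_def by (intro borel_measurable_max borel_measurable_min borel_measurable_const)

lemma is_solutionD:
  assumes "is_solution \<Omega> A F u"
  shows "u \<in> L_space 2 \<Omega>" "AE x in lebesgue_on \<Omega>. u x \<ge> 0"
    "k > 0 \<Longrightarrow> (\<lambda>x. G k (u x)) \<in> H10 \<Omega>"
    "k > 0 \<Longrightarrow> \<phi> \<in> H10 \<Omega> \<inter> Linf_space \<Omega> \<Longrightarrow> (\<lambda>x. \<phi> x * T k (u x)) \<in> H10 \<Omega>"
  using assms unfolding is_solution_def by blast+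

text \<open>The data showing \<open>z\<^sup>2 \<in> \<V>(\<Omega>)\<close> are \<open>\<phi> = z\<close>, \<open>g = 2 \<^sup>tA Dz\<close> and \<open>f = - 2 \<^sup>tA Dz \<cdot> Dz\<close>; they come from the product
  rule for the divergence. Inserting them in the definition of solution, the three integrals on the left combine
  to one. The function \<open>W\<close> is the product \<open>z Du\<close>, written so that only weak gradients of elements of
  \<open>H\<^sub>0\<^sup>1(\<Omega>)\<close> occur; the gradient of \<open>u\<close> itself need not be square integrable.\<close>

lemma solution_identity:
  fixes A :: "real ^ 'n \<Rightarrow> real ^ 'n ^ 'n"
  assumes \<Omega>: "open \<Omega>" "bounded \<Omega>" and A: "\<And>i j. (\<lambda>x. A x $ i $ j) \<in> Linf_space \<Omega>"
    and u: "is_solution \<Omega> A F u" and k: "k > 0"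
    and z: "H10_grad \<Omega> z Dz" "\<And>x. \<bar>z x\<bar> \<le> C"
    and z2: "H10_grad \<Omega> (\<lambda>x. (z x)\<^sup>2) (\<lambda>x. (2 * z x) *\<^sub>R Dz x)"
    and W: "\<And>x. W x = z x *\<^sub>R weak_grad \<Omega> (\<lambda>y. G k (u y)) x
      + weak_grad \<Omega> (\<lambda>y. z y * T k (u y)) x - T k (u x) *\<^sub>R Dz x"
  shows "L2 (lebesgue_on \<Omega>) W"
    "(\<integral>\<^sup>+x. F x (u x) * ennreal ((z x)\<^sup>2) \<partial>lebesgue_on \<Omega>) < \<infinity>"
    "2 * (LINT x|lebesgue_on \<Omega>. (transpose (A x) *v Dz x) \<bullet> W x)
      = enn2real (\<integral>\<^sup>+x. F x (u x) * ennreal ((z x)\<^sup>2) \<partial>lebesgue_on \<Omega>)"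
proof -
  let ?M = "lebesgue_on \<Omega>"
  define B where "B x = transpose (A x) *v Dz x" for x
  define v where "v x = (z x)\<^sup>2" for x
  define DG where "DG = weak_grad \<Omega> (\<lambda>y. G k (u y))"
  define DT where "DT = weak_grad \<Omega> (\<lambda>y. z y * T k (u y))"
  note Lz = H10_grad_L2[OF z(1)]
  have mz: "z \<in> borel_measurable ?M" by (rule L2_measurable[OF Lz(1)])
  have LB: "L2 ?M B" unfolding B_def by (rule L2_transpose_matrix_vector_mult[OF A Lz(2)])
  have z_in: "z \<in> H10 \<Omega> \<inter> Linf_space \<Omega>"
    using H10_grad_imp_H10(1)[OF \<Omega> z(1)] mz z(2) by (auto simp: Linf_space_def)
  have C0: "C \<ge> 0" using z(2)[of 0] by simp
  have v2: "\<bar>(z x)\<^sup>2\<bar> \<le> C\<^sup>2" for x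
    using z(2)[of x] C0 by (simp add: abs_le_square_iff[symmetric])
  have v_in: "v \<in> H10 \<Omega> \<inter> Linf_space \<Omega>"
    using H10_grad_imp_H10(1)[OF \<Omega> z2] v2 L2_measurable[OF H10_grad_L2(1)[OF z2]]
    by (auto simp: Linf_space_def v_def[abs_def])
  have Dv: "AE x in ?M. transpose (A x) *v weak_grad \<Omega> v x = (2 * z x) *\<^sub>R B x"
    using H10_grad_imp_H10(2)[OF \<Omega> z2] unfolding v_def[abs_def, symmetric]
    by eventually_elim (simp add: B_def matrix_vector_mult_scaleR)
  have Lv: "L2 ?M (\<lambda>x. transpose (A x) *v weak_grad \<Omega> v x)"
    using H10_grad_L2(2)[OF H10_imp_H10_grad[OF \<Omega>]] v_in by (intro L2_transpose_matrix_vector_mult A) blast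
  have LzB: "L2 ?M (\<lambda>x. z x *\<^sub>R B x)"
    by (rule L2_mult_bounded[OF LB mz z(2)])
  have LzB2: "L2 ?M (\<lambda>x. (2 * z x) *\<^sub>R B x)"
    using L2_scaleR[OF LzB, of 2] by simp
  have u1: "u \<in> L_space 2 \<Omega>" "(\<lambda>x. G k (u x)) \<in> H10 \<Omega>" "(\<lambda>x. z x * T k (u x)) \<in> H10 \<Omega>"
    by (rule is_solutionD[OF u] is_solutionD(3,4)[OF u k] z_in)+
  have mu: "u \<in> borel_measurable ?M" using u1(1) by (simp add: L_space_def)
  have mT: "(\<lambda>x. T k (u x)) \<in> borel_measurable ?M" by (rule T_measurable[OF mu])
  have LDG: "L2 ?M DG" unfolding DG_def using H10_grad_L2(2)[OF H10_imp_H10_grad[OF \<Omega> u1(2)]] .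
  have LDT: "L2 ?M DT" unfolding DT_def using H10_grad_L2(2)[OF H10_imp_H10_grad[OF \<Omega> u1(3)]] .
  have LTD: "L2 ?M (\<lambda>x. T k (u x) *\<^sub>R Dz x)"
    by (rule L2_mult_bounded[OF Lz(2) mT T_bound[OF k]])
  have LzDG: "L2 ?M (\<lambda>x. z x *\<^sub>R DG x)" by (rule L2_mult_bounded[OF LDG mz z(2)])
  have "W = (\<lambda>x. z x *\<^sub>R DG x + DT x - T k (u x) *\<^sub>R Dz x)"
    using W by (simp add: fun_eq_iff DG_def DT_def)
  then show "L2 ?M W"
    using L2_diff[OF L2_add[OF LzDG LDT] LTD] by simp
  let ?f = "\<lambda>x. - 2 * (B x \<bullet> Dz x)"
  have vd: "V_data \<Omega> A v {0} (\<lambda>_. z) (\<lambda>_ x. 2 *\<^sub>R B x) ?f"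
    unfolding V_data_def
  proof (intro conjI ballI)
    show "z \<in> H10 \<Omega> \<inter> Linf_space \<Omega>" by (rule z_in)
    show "(\<lambda>x. 2 *\<^sub>R B x) \<in> L_space 2 \<Omega>" by (simp add: L_space_2_iff L2_scaleR LB)
    show "?f \<in> L_space 1 \<Omega>" using L2_inner_integrable[OF LB Lz(2)] by (simp add: L_space_1_iff)
    fix \<psi> assume \<psi>: "\<psi> \<in> test_functions \<Omega>"
    note L\<psi> = test_function_L2[OF \<Omega> \<psi>]
    obtain K where K: "\<And>x. \<bar>\<psi> x\<bar> \<le> K" using test_functions_bounded[OF \<psi>] by metis
    have Lzg: "L2 ?M (\<lambda>x. z x *\<^sub>R grad \<psi> x)" by (rule L2_mult_bounded[OF L\<psi>(2) mz z(2)])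
    have LpD: "L2 ?M (\<lambda>x. \<psi> x *\<^sub>R Dz x)" by (rule L2_mult_bounded[OF Lz(2) L2_measurable[OF L\<psi>(1)] K])
    have w: "has_weak_grad \<Omega> (\<lambda>x. z x * \<psi> x) (\<lambda>x. z x *\<^sub>R grad \<psi> x + \<psi> x *\<^sub>R Dz x)"
      by (rule has_weak_grad_mult[OF \<Omega> z(1) L\<psi> H10_grad_has_weak_grad[OF \<Omega> test_function_H10_grad[OF \<Omega> \<psi>]]])
    have ae: "AE x in ?M. weak_grad \<Omega> (\<lambda>y. z y * \<psi> y) x = z x *\<^sub>R grad \<psi> x + \<psi> x *\<^sub>R Dz x"
      by (rule weak_grad_AE_eq[OF \<Omega>(1) w])
    have Lw: "L2 ?M (weak_grad \<Omega> (\<lambda>y. z y * \<psi> y))"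
      by (rule L2_cong_AE[OF open_in_sets_lebesgue[OF \<Omega>] L2_add[OF Lzg LpD]]) (use ae in eventually_elim, simp)
    note i1 = L2_inner_integrable[OF LB Lzg] and i2 = L2_inner_integrable[OF LB LpD]
    have e1: "neg_div \<Omega> (\<lambda>x. transpose (A x) *v weak_grad \<Omega> v x) \<psi> = (LINT x|?M. 2 * (B x \<bullet> (z x *\<^sub>R grad \<psi> x)))"
      unfolding neg_div_def
      by (rule integral_cong_AE[OF borel_measurable_integrable[OF L2_inner_integrable[OF Lv L\<psi>(2)]]
          borel_measurable_integrable[OF integrable_mult_right[OF i1]]])
        (use Dv in eventually_elim, simp)
    have e2: "mult_neg_div \<Omega> z (\<lambda>x. 2 *\<^sub>R B x) \<psi>
        = (LINT x|?M. 2 * (B x \<bullet> (z x *\<^sub>R grad \<psi> x)) + 2 * (B x \<bullet> (\<psi> x *\<^sub>R Dz x)))"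
      unfolding mult_neg_div_def
      by (rule integral_cong_AE[OF borel_measurable_integrable[OF L2_inner_integrable[OF L2_scaleR[OF LB] Lw]]
          borel_measurable_integrable[OF Bochner_Integration.integrable_add[OF integrable_mult_right[OF i1] integrable_mult_right[OF i2]]]])
        (use ae in eventually_elim, simp add: inner_add_right)
    have e3: "fun_distr \<Omega> ?f \<psi> = - (LINT x|?M. 2 * (B x \<bullet> (\<psi> x *\<^sub>R Dz x)))"
      unfolding fun_distr_def by (subst integral_minus[symmetric], rule Bochner_Integration.integral_cong) auto
    show "neg_div \<Omega> (\<lambda>x. transpose (A x) *v weak_grad \<Omega> v x) \<psi>
        = (\<Sum>i\<in>{0}. mult_neg_div \<Omega> z (\<lambda>x. 2 *\<^sub>R B x) \<psi>) + fun_distr \<Omega> ?f \<psi>"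
      using e1 e2 e3 i1 i2 by simp
  qed simp_all
  have vV: "v \<in> V_space \<Omega> A" using v_in vd unfolding V_space_def by blast
  have v0: "AE x in ?M. v x \<ge> 0" by (simp add: v_def)
  have sol: "(\<integral>\<^sup>+x. F x (u x) * ennreal (v x) \<partial>?M) < \<infinity> \<and>
         (LINT x|?M. (transpose (A x) *v weak_grad \<Omega> v x) \<bullet> DG x)
           + (\<Sum>i\<in>{0::nat}. LINT x|?M. (2 *\<^sub>R B x) \<bullet> DT x)
           + (LINT x|?M. ?f x * T k (u x))
           = enn2real (\<integral>\<^sup>+x. F x (u x) * ennreal (v x) \<partial>?M)"
    using u vV v0 vd k unfolding is_solution_def DG_def DT_def by blast
  then show "(\<integral>\<^sup>+x. F x (u x) * ennreal ((z x)\<^sup>2) \<partial>?M) < \<infinity>" by (simp add: v_def)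
  note j1 = L2_inner_integrable[OF LB LzDG] and j2 = L2_inner_integrable[OF LB LDT] and j3 = L2_inner_integrable[OF LB LTD]
  have e1: "(LINT x|?M. (transpose (A x) *v weak_grad \<Omega> v x) \<bullet> DG x) = (LINT x|?M. 2 * (B x \<bullet> (z x *\<^sub>R DG x)))"
    by (rule integral_cong_AE[OF borel_measurable_integrable[OF L2_inner_integrable[OF Lv LDG]]
          borel_measurable_integrable[OF integrable_mult_right[OF j1]]])
      (use Dv in eventually_elim, simp)
  have e3: "(LINT x|?M. ?f x * T k (u x)) = (LINT x|?M. - 2 * (B x \<bullet> (T k (u x) *\<^sub>R Dz x)))"
    by (rule Bochner_Integration.integral_cong) auto
  have "(LINT x|?M. B x \<bullet> W x) = (LINT x|?M. B x \<bullet> (z x *\<^sub>R DG x) + B x \<bullet> DT x - B x \<bullet> (T k (u x) *\<^sub>R Dz x))"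
    by (rule Bochner_Integration.integral_cong)
      (auto simp: W DG_def DT_def inner_add_right inner_diff_right)
  also have "\<dots> = (LINT x|?M. B x \<bullet> (z x *\<^sub>R DG x)) + (LINT x|?M. B x \<bullet> DT x) - (LINT x|?M. B x \<bullet> (T k (u x) *\<^sub>R Dz x))"
    using j1 j2 j3 by simp
  finally have "2 * (LINT x|?M. B x \<bullet> W x) = (LINT x|?M. 2 * (B x \<bullet> (z x *\<^sub>R DG x))) + (LINT x|?M. (2 *\<^sub>R B x) \<bullet> DT x)
      + (LINT x|?M. - 2 * (B x \<bullet> (T k (u x) *\<^sub>R Dz x)))"
    by simp
  then show "2 * (LINT x|?M. (transpose (A x) *v Dz x) \<bullet> W x)
      = enn2real (\<integral>\<^sup>+x. F x (u x) * ennreal ((z x)\<^sup>2) \<partial>?M)"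
    using sol e1 e3 by (simp add: B_def v_def)
qed

section \<open>Comparison of solutions\<close>

text \<open>The test function is \<open>z\<^sup>2\<close> with \<open>z = flat (p - k)\<close> and \<open>p = G\<^sub>k(u) - \<eta> T\<^sub>k(w) - G\<^sub>k(w)\<close>. The cut-off \<open>\<eta>\<close>, a
  smooth function of \<open>G\<^sub>k(u)\<close>, is what makes the term with \<open>T\<^sub>k(w)\<close> belong to \<open>H\<^sub>0\<^sup>1(\<Omega>)\<close>. It is invisible where
  \<open>p > k\<close>, so \<open>z\<close> depends there on \<open>u - w\<close> only.\<close>

lemma comparison_up_to_constant:
  fixes A :: "real ^ 'n \<Rightarrow> real ^ 'n ^ 'n"
  assumes \<Omega>: "open \<Omega>" "bounded \<Omega>" and A: "\<And>i j. (\<lambda>x. A x $ i $ j) \<in> Linf_space \<Omega>"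
    and \<alpha>: "\<alpha> > 0" "AE x in lebesgue_on \<Omega>. \<forall>\<xi>. (A x *v \<xi>) \<bullet> \<xi> \<ge> \<alpha> * (norm \<xi>)\<^sup>2"
    and F: "AE x in lebesgue_on \<Omega>. \<forall>s t. 0 \<le> t \<and> t \<le> s \<longrightarrow> F x s \<le> F x t"
    and u: "is_solution \<Omega> A F u" and w: "is_solution \<Omega> A F w" and k: "k > 0"
  shows "AE x in lebesgue_on \<Omega>. u x \<le> w x + 2 * k"
proof -
  let ?M = "lebesgue_on \<Omega>"
  have u0: "AE x in ?M. u x \<ge> 0" and w0: "AE x in ?M. w x \<ge> 0"
    by (rule is_solutionD(2)[OF u] is_solutionD(2)[OF w])+
  define Q where "Q x = G k (u x)" for x
  define H where "H x = G k (w x)" for x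
  define DQ where "DQ = weak_grad \<Omega> Q"
  define DH where "DH = weak_grad \<Omega> H"
  have hQ: "H10_grad \<Omega> Q DQ" and hH: "H10_grad \<Omega> H DH"
    unfolding DQ_def DH_def Q_def[abs_def] H_def[abs_def]
    by (rule H10_imp_H10_grad[OF \<Omega> is_solutionD(3)[OF u k]] H10_imp_H10_grad[OF \<Omega> is_solutionD(3)[OF w k]])+
  have fk: "flat k > 0" using k by (simp add: flat_pos_iff)
  define \<eta> where "\<eta> x = 1 - flat (k - Q x) / flat k" for x
  have h\<eta>: "H10_grad \<Omega> \<eta> (\<lambda>x. (flat' (k - Q x) / flat k) *\<^sub>R DQ x)"
    unfolding \<eta>_def[abs_def]
  proof (rule H10_grad_compose[OF \<Omega> hQ, where S = "\<lambda>s. 1 - flat (k - s) / flat k" and S' = "\<lambda>s. flat' (k - s) / flat k"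
        and C = "2 / flat k"])
    show "smooth_real (\<lambda>s. 1 - flat (k - s) / flat k)"
      using smooth_real_affine[OF smooth_flat, of 1 "- 1 / flat k" "-1" k] by simp
    show "1 - flat (k - 0) / flat k = 0" using fk by simp
    show "((\<lambda>s. 1 - flat (k - s) / flat k) has_real_derivative flat' (k - s) / flat k) (at s)" for s
    proof -
      have "((\<lambda>s. flat (k - s)) has_real_derivative - flat' (k - s)) (at s)"
        by (rule flat_compose_has_derivative[where f' = "-1"]) (auto intro!: derivative_eq_intros)
      from DERIV_diff[OF DERIV_const[of 1] DERIV_cdivide[OF this, of "flat k"]] show ?thesis by simp
    qed
    show "continuous_on UNIV (\<lambda>s. flat' (k - s) / flat k)"
      using fk by (intro continuous_on_divide continuous_on_const continuous_on_compose2[OF continuous_flat'])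
        (auto intro!: continuous_intros)
    show "\<bar>flat' (k - s) / flat k\<bar> \<le> 2 / flat k" for s
      using fk flat'_nonneg[of "k - s"] flat'_le[of "k - s"] by (simp add: divide_right_mono)
  qed
  have "\<bar>\<eta> x\<bar> \<le> 1 + 1 / flat k" for x
  proof -
    have "0 \<le> flat (k - Q x) / flat k" "flat (k - Q x) / flat k \<le> 1 / flat k"
      using fk by (simp_all add: flat_nonneg flat_le_1 divide_right_mono)
    then show ?thesis by (simp add: \<eta>_def)
  qed
  then have \<eta>_in: "\<eta> \<in> H10 \<Omega> \<inter> Linf_space \<Omega>"
    using H10_grad_imp_H10(1)[OF \<Omega> h\<eta>] L2_measurable[OF H10_grad_L2(1)[OF h\<eta>]]
    by (auto simp: Linf_space_def)
  define R where "R x = \<eta> x * T k (w x)" for x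
  define DR where "DR = weak_grad \<Omega> R"
  have hR: "H10_grad \<Omega> R DR"
    unfolding DR_def R_def[abs_def] by (rule H10_imp_H10_grad[OF \<Omega> is_solutionD(4)[OF w k \<eta>_in]])
  define p where "p x = Q x - (R x + H x)" for x
  define Dp where "Dp x = DQ x - (DR x + DH x)" for x
  have hp: "H10_grad \<Omega> p Dp"
    unfolding p_def[abs_def] Dp_def[abs_def] by (intro H10_grad_diff[OF \<Omega>] H10_grad_add[OF \<Omega>] hQ hR hH)
  define z where "z x = flat (p x - k)" for x
  define Dz where "Dz x = flat' (p x - k) *\<^sub>R Dp x" for x
  have flat_shift: "((\<lambda>s. flat (s - k)) has_real_derivative flat' (s - k)) (at s)" for s
    by (rule flat_compose_has_derivative[where f' = 1]) (auto intro!: derivative_eq_intros)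
  have cont_flat'_shift: "continuous_on UNIV (\<lambda>s. flat' (s - k))"
    by (rule continuous_on_compose2[OF continuous_flat']) (auto intro!: continuous_intros)
  have hz: "H10_grad \<Omega> z Dz"
    unfolding z_def[abs_def] Dz_def[abs_def]
  proof (rule H10_grad_compose[OF \<Omega> hp, where S = "\<lambda>s. flat (s - k)" and S' = "\<lambda>s. flat' (s - k)" and C = 2])
    show "smooth_real (\<lambda>s. flat (s - k))"
      using smooth_real_affine[OF smooth_flat, of 0 1 1 "- k"] by simp
    show "flat (0 - k) = 0" using k by (simp add: flat_eq_0_iff)
    show "((\<lambda>s. flat (s - k)) has_real_derivative flat' (s - k)) (at s)" for s by (rule flat_shift)
    show "continuous_on UNIV (\<lambda>s. flat' (s - k))" by (rule cont_flat'_shift)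
    show "\<bar>flat' (s - k)\<bar> \<le> 2" for s
      using flat'_nonneg[of "s - k"] flat'_le[of "s - k"] by simp
  qed
  have hz2: "H10_grad \<Omega> (\<lambda>x. (z x)\<^sup>2) (\<lambda>x. (2 * z x) *\<^sub>R Dz x)"
  proof -
    have "H10_grad \<Omega> (\<lambda>x. (flat (p x - k))\<^sup>2) (\<lambda>x. (2 * flat (p x - k) * flat' (p x - k)) *\<^sub>R Dp x)"
    proof (rule H10_grad_compose[OF \<Omega> hp, where S = "\<lambda>s. (flat (s - k))\<^sup>2"
          and S' = "\<lambda>s. 2 * flat (s - k) * flat' (s - k)" and C = 4])
      show "smooth_real (\<lambda>s. (flat (s - k))\<^sup>2)"
        using smooth_real_affine[OF smooth_flat, of 0 1 "1/2" "- k/2"]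
        by (simp add: flat_double[symmetric] diff_divide_distrib)
      show "(flat (0 - k))\<^sup>2 = 0" using k by (simp add: flat_eq_0_iff)
      show "((\<lambda>s. (flat (s - k))\<^sup>2) has_real_derivative 2 * flat (s - k) * flat' (s - k)) (at s)" for s
        using DERIV_power[OF flat_shift, of 2 s] by (simp add: mult.assoc mult.commute[of "flat' _"])
      have "continuous_on UNIV (\<lambda>s. flat (s - k))"
        using flat_shift by (intro continuous_at_imp_continuous_on ballI DERIV_isCont)
      then show "continuous_on UNIV (\<lambda>s. 2 * flat (s - k) * flat' (s - k))"
        by (intro continuous_on_mult continuous_on_const cont_flat'_shift)
      show "\<bar>2 * flat (s - k) * flat' (s - k)\<bar> \<le> 4" for s
      proof -
        have "flat (s - k) * flat' (s - k) \<le> 1 * 2"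
          by (intro mult_mono flat_le_1 flat'_le flat'_nonneg) auto
        then show ?thesis using flat_nonneg[of "s - k"] flat'_nonneg[of "s - k"] by (simp add: abs_mult)
      qed
    qed
    then show ?thesis by (simp add: z_def Dz_def mult.assoc)
  qed
  have zC: "\<bar>z x\<bar> \<le> 1" for x by (simp add: z_def flat_nonneg flat_le_1)
  have z_in: "z \<in> H10 \<Omega> \<inter> Linf_space \<Omega>"
    using H10_grad_imp_H10(1)[OF \<Omega> hz] L2_measurable[OF H10_grad_L2(1)[OF hz]] zC
    by (auto simp: Linf_space_def)
  \<comment> \<open>The facts \<open>large\<close> and \<open>act\<close> say that, almost everywhere, \<open>p > k\<close> is equivalent to \<open>u > w + 2 k\<close>.\<close>
  have large: "\<eta> x = 1 \<and> p x = u x - k - w x" if "u x > 2 * k" for x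
    using that k by (auto simp: \<eta>_def p_def R_def Q_def H_def G_def T_def flat_def)
  have act: "u x > 2 * k \<and> R x = T k (w x) \<and> T k (u x) = k \<and> w x \<le> u x"
    if "u x \<ge> 0" "w x \<ge> 0" "p x > k" for x
  proof -
    have Q0: "Q x \<ge> 0" using that(1) k by (auto simp: Q_def G_def T_def)
    have "flat (k - Q x) \<le> flat k" using Q0 by (intro flat_mono) simp
    then have "\<eta> x \<ge> 0" using fk by (simp add: \<eta>_def)
    moreover have "T k (w x) \<ge> 0" "H x \<ge> 0" using that(2) k by (auto simp: H_def G_def T_def)
    ultimately have "R x + H x \<ge> 0" by (simp add: R_def)
    then have "Q x > k" using that(3) by (simp add: p_def)
    then have "u x > 2 * k" using k by (auto simp: Q_def G_def T_def split: if_splits)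
    with large[OF this] that k show ?thesis by (auto simp: R_def T_def)
  qed
  have z0: "z x = 0" "Dz x = 0" if "\<not> p x > k" for x
    using that by (simp_all add: z_def Dz_def flat_eq_0_iff flat'_eq_0_iff)
  define Wu where "Wu x = z x *\<^sub>R weak_grad \<Omega> (\<lambda>y. G k (u y)) x + weak_grad \<Omega> (\<lambda>y. z y * T k (u y)) x - T k (u x) *\<^sub>R Dz x" for x
  define Ww where "Ww x = z x *\<^sub>R weak_grad \<Omega> (\<lambda>y. G k (w y)) x + weak_grad \<Omega> (\<lambda>y. z y * T k (w y)) x - T k (w x) *\<^sub>R Dz x" for x
  note su = solution_identity[OF \<Omega> A u k hz zC hz2 Wu_def]
  note sw = solution_identity[OF \<Omega> A w k hz zC hz2 Ww_def]
  \<comment> \<open>Where \<open>z\<close> does not vanish, \<open>T\<^sub>k(u)\<close> is the constant \<open>k\<close>, and \<open>T\<^sub>k(w)\<close> may be replaced by \<open>R \<in> H\<^sub>0\<^sup>1(\<Omega>)\<close>.\<close>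
  have Tu: "AE x in ?M. weak_grad \<Omega> (\<lambda>y. z y * T k (u y)) x = k *\<^sub>R Dz x"
  proof (rule weak_grad_unique[OF \<Omega>(1)])
    show "has_weak_grad \<Omega> (\<lambda>y. z y * T k (u y)) (weak_grad \<Omega> (\<lambda>y. z y * T k (u y)))"
      by (rule H10_grad_has_weak_grad[OF \<Omega> H10_imp_H10_grad[OF \<Omega> is_solutionD(4)[OF u k z_in]]])
    show "has_weak_grad \<Omega> (\<lambda>y. k * z y) (\<lambda>x. k *\<^sub>R Dz x)"
      by (intro H10_grad_has_weak_grad[OF \<Omega>] H10_grad_scaleR[OF \<Omega>] hz)
    show "AE x in ?M. z x * T k (u x) = k * z x"
      using u0 w0 by eventually_elim (metis act z0(1) mult.commute mult_zero_left mult_zero_right)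
  qed
  have Tw: "AE x in ?M. weak_grad \<Omega> (\<lambda>y. z y * T k (w y)) x = z x *\<^sub>R DR x + R x *\<^sub>R Dz x"
  proof (rule weak_grad_unique[OF \<Omega>(1)])
    show "has_weak_grad \<Omega> (\<lambda>y. z y * T k (w y)) (weak_grad \<Omega> (\<lambda>y. z y * T k (w y)))"
      by (rule H10_grad_has_weak_grad[OF \<Omega> H10_imp_H10_grad[OF \<Omega> is_solutionD(4)[OF w k z_in]]])
    show "has_weak_grad \<Omega> (\<lambda>y. z y * R y) (\<lambda>x. z x *\<^sub>R DR x + R x *\<^sub>R Dz x)"
      by (intro has_weak_grad_mult[OF \<Omega>] hz H10_grad_L2[OF hR] H10_grad_has_weak_grad[OF \<Omega>] hR)
    show "AE x in ?M. z x * T k (w x) = z x * R x"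
      using u0 w0 by eventually_elim (metis act z0(1) mult_zero_left)
  qed
  have dW: "AE x in ?M. Wu x - Ww x = z x *\<^sub>R Dp x"
    using Tu Tw u0 w0
  proof eventually_elim
    case (elim x)
    have "k - T k (u x) = 0 \<and> R x - T k (w x) = 0 \<or> Dz x = 0"
      using act[OF elim(3,4)] z0(2)[of x] by (metis diff_self)
    then have t: "T k (u x) *\<^sub>R Dz x = k *\<^sub>R Dz x" "T k (w x) *\<^sub>R Dz x = R x *\<^sub>R Dz x" by auto
    have "Wu x = z x *\<^sub>R DQ x" "Ww x = z x *\<^sub>R DH x + z x *\<^sub>R DR x"
      unfolding Wu_def Ww_def elim(1,2) t DQ_def DH_def Q_def[abs_def] H_def[abs_def] by simp_all
    then show ?case by (simp add: Dp_def algebra_simps)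
  qed
  define B where "B x = transpose (A x) *v Dz x" for x
  have LB: "L2 ?M B" unfolding B_def by (rule L2_transpose_matrix_vector_mult[OF A H10_grad_L2(2)[OF hz]])
  have LzD: "L2 ?M (\<lambda>x. z x *\<^sub>R Dp x)"
    by (rule L2_mult_bounded[OF H10_grad_L2(2)[OF hp] L2_measurable[OF H10_grad_L2(1)[OF hz]] zC])
  have "(\<integral>\<^sup>+x. F x (u x) * ennreal ((z x)\<^sup>2) \<partial>?M) \<le> (\<integral>\<^sup>+x. F x (w x) * ennreal ((z x)\<^sup>2) \<partial>?M)"
  proof (rule nn_integral_mono_AE)
    show "AE x in ?M. F x (u x) * ennreal ((z x)\<^sup>2) \<le> F x (w x) * ennreal ((z x)\<^sup>2)"
      using F u0 w0
    proof eventually_elim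
      case (elim x)
      show ?case
      proof (cases "p x > k")
        case True
        then show ?thesis using act[OF elim(2,3)] elim(1,3) by (intro mult_right_mono) auto
      qed (simp add: z0)
    qed
  qed
  then have "2 * (LINT x|?M. B x \<bullet> Wu x) \<le> 2 * (LINT x|?M. B x \<bullet> Ww x)"
    using su(2,3) sw(2,3) unfolding B_def by (simp add: enn2real_mono)
  moreover have "(LINT x|?M. B x \<bullet> (z x *\<^sub>R Dp x)) = (LINT x|?M. B x \<bullet> (Wu x - Ww x))"
    by (rule integral_cong_AE[OF borel_measurable_integrable[OF L2_inner_integrable[OF LB LzD]]
          borel_measurable_integrable[OF L2_inner_integrable[OF LB L2_diff[OF su(1) sw(1)]]]])
      (use dW in eventually_elim, simp)
  ultimately have le0: "(LINT x|?M. B x \<bullet> (z x *\<^sub>R Dp x)) \<le> 0"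
    using L2_inner_integrable[OF LB su(1)] L2_inner_integrable[OF LB sw(1)] by (simp add: inner_diff_right)
  \<comment> \<open>Ellipticity, since \<open>B = flat'(p - k) \<^sup>tA Dp\<close>.\<close>
  have low: "AE x in ?M. z x * flat' (p x - k) * (\<alpha> * (norm (Dp x))\<^sup>2) \<le> B x \<bullet> (z x *\<^sub>R Dp x)"
    using \<alpha>(2)
  proof eventually_elim
    case (elim x)
    have "B x \<bullet> (z x *\<^sub>R Dp x) = z x * flat' (p x - k) * ((A x *v Dp x) \<bullet> Dp x)"
      unfolding B_def Dz_def transpose_matrix_inner
      by (simp add: matrix_vector_mult_scaleR inner_commute)
    moreover have "0 \<le> z x * flat' (p x - k)" by (simp add: z_def flat_nonneg flat'_nonneg)
    ultimately show ?case using elim mult_left_mono by metis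
  qed
  have nn: "AE x in ?M. 0 \<le> B x \<bullet> (z x *\<^sub>R Dp x)"
    using low
  proof eventually_elim
    case (elim x)
    have "0 \<le> z x * flat' (p x - k) * (\<alpha> * (norm (Dp x))\<^sup>2)"
      using \<alpha>(1) by (simp add: z_def flat_nonneg flat'_nonneg)
    then show ?case using elim by linarith
  qed
  have "(LINT x|?M. B x \<bullet> (z x *\<^sub>R Dp x)) = 0"
    using le0 integral_nonneg_AE[OF nn] by simp
  then have "AE x in ?M. B x \<bullet> (z x *\<^sub>R Dp x) = 0"
    using integral_nonneg_eq_0_iff_AE[OF L2_inner_integrable[OF LB LzD] nn] by simp
  with low have "AE x in ?M. Dz x = 0"
  proof eventually_elim
    case (elim x)
    show ?case
    proof (cases "p x > k")
      case True
      then have pos: "z x * flat' (p x - k) > 0" by (simp add: z_def flat_def flat'_def)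
      have "z x * flat' (p x - k) * (\<alpha> * (norm (Dp x))\<^sup>2) \<le> 0" using elim by linarith
      then have "\<alpha> * (norm (Dp x))\<^sup>2 \<le> 0" using mult_pos_pos[OF pos] by (meson not_le)
      then have "Dp x = 0" using \<alpha>(1) by (simp add: mult_le_0_iff)
      then show ?thesis by (simp add: Dz_def)
    qed (rule z0)
  qed
  then have "AE x in ?M. z x = 0" by (rule H10_zero_grad[OF \<Omega> hz])
  then show ?thesis using u0 w0
  proof eventually_elim
    case (elim x)
    then have "p x \<le> k" by (simp add: z_def flat_eq_0_iff)
    then show ?case using large[of x] elim(3) by (cases "u x > 2 * k") auto
  qed
qed

lemma comparison_principle:
  fixes A :: "real ^ 'n \<Rightarrow> real ^ 'n ^ 'n"
  assumes \<Omega>: "open \<Omega>" "bounded \<Omega>" and A: "\<And>i j. (\<lambda>x. A x $ i $ j) \<in> Linf_space \<Omega>"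
    and \<alpha>: "\<alpha> > 0" "AE x in lebesgue_on \<Omega>. \<forall>\<xi>. (A x *v \<xi>) \<bullet> \<xi> \<ge> \<alpha> * (norm \<xi>)\<^sup>2"
    and F: "AE x in lebesgue_on \<Omega>. \<forall>s t. 0 \<le> t \<and> t \<le> s \<longrightarrow> F x s \<le> F x t"
    and u: "is_solution \<Omega> A F u" and w: "is_solution \<Omega> A F w"
  shows "AE x in lebesgue_on \<Omega>. u x \<le> w x"
proof -
  have "AE x in lebesgue_on \<Omega>. \<forall>n. u x \<le> w x + 2 * inverse (real (Suc n))"
    by (intro AE_all_countable[THEN iffD2] allI comparison_up_to_constant[OF \<Omega> A \<alpha> F u w]) simp
  then show ?thesis
  proof eventually_elim
    case (elim x)
    have "(\<lambda>n. w x + 2 * inverse (real (Suc n))) \<longlonglongrightarrow> w x + 2 * 0"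
      by (intro tendsto_intros LIMSEQ_inverse_real_of_nat)
    then have "(\<lambda>n. w x + 2 * inverse (real (Suc n))) \<longlonglongrightarrow> w x" by simp
    then show ?case by (rule LIMSEQ_le_const) (use elim in blast)
  qed
qed

theorem theorem4p3:
  fixes \<Omega> :: "(real ^ 'n) set"
    and A :: "real ^ 'n \<Rightarrow> real ^ 'n ^ 'n"
    and F :: "real ^ 'n \<Rightarrow> real \<Rightarrow> ennreal"
    and h :: "real ^ 'n \<Rightarrow> real"
    and \<Gamma> \<Gamma>' :: "real \<Rightarrow> real"
    and r \<alpha> :: real
    and u w :: "real ^ 'n \<Rightarrow> real"
  assumes "open \<Omega>" and "bounded \<Omega>"
    and "\<And>i j. (\<lambda>x. A x $ i $ j) \<in> Linf_space \<Omega>"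
    and "\<alpha> > 0"
    and "AE x in lebesgue_on \<Omega>. \<forall>\<xi>. (A x *v \<xi>) \<bullet> \<xi> \<ge> \<alpha> * (norm \<xi>)\<^sup>2"
    and "caratheodory \<Omega> F"
    and "AE x in lebesgue_on \<Omega>. \<forall>s>0. F x s \<le> ennreal (h x / \<Gamma> s)"
    and "AE x in lebesgue_on \<Omega>. h x \<ge> 0"
    and "h \<in> L_space r \<Omega>"
    and "CARD('n) \<ge> 3 \<Longrightarrow> r = 2 * real CARD('n) / (real CARD('n) + 2)"
    and "CARD('n) = 2 \<Longrightarrow> r > 1"
    and "CARD('n) = 1 \<Longrightarrow> r = 1"
    and "\<And>s. s \<ge> 0 \<Longrightarrow> \<Gamma> s \<ge> 0"
    and "\<And>s. s \<ge> 0 \<Longrightarrow> (\<Gamma> has_real_derivative \<Gamma>' s) (at s within {0..})"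
    and "continuous_on {0..} \<Gamma>'"
    and "\<Gamma> 0 = 0"
    and "\<And>s. s > 0 \<Longrightarrow> \<Gamma>' s > 0"
    and "AE x in lebesgue_on \<Omega>. \<forall>s t. 0 \<le> t \<and> t \<le> s \<longrightarrow> F x s \<le> F x t"
    and "is_solution \<Omega> A F u"
    and "is_solution \<Omega> A F w"
  shows "AE x in lebesgue_on \<Omega>. u x = w x"
proof -
  note bounds = \<open>open \<Omega>\<close> \<open>bounded \<Omega>\<close> assms(3) \<open>\<alpha> > 0\<close> assms(5,18)
  have "AE x in lebesgue_on \<Omega>. u x \<le> w x" "AE x in lebesgue_on \<Omega>. w x \<le> u x"
    using comparison_principle[OF bounds] \<open>is_solution \<Omega> A F u\<close> \<open>is_solution \<Omega> A F w\<close> by blast+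
  then show ?thesis by eventually_elim simp
qed

end
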